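(* Let $d\ge 2$ and let $K\subset\mathbb{R}^d$ be a bounded set containing $B'_{d-1}(o,r)$ for some $r>0$. Let $\mathbb{Q}$ be a probability measure on $\mathbb{S}^{d-1}_+$ such that there is a constant $p_S>0$ with $$\mathbb{Q}\big(\overline{\mathcal{S}(z_1,\dots,z_{d-1})}\big)>p_S\qquad\text{for all }(z_1,\dots,z_{d-1})\in\{-1,1\}^{d-1}.$$ Then for the cylinder model with directional distribution $\mathbb{Q}$ there exist constants $0<c_1\le c_2<\infty$ depending on $K$ such that $$\mathbb{P}\left(c_1\le\frac{R_\rho(K)}{(\log\rho/\rho)^{1/(d-1)}}\le c_2\right)\to 1\qquad\text{as }\rho\to\infty.$$
   Context: Notation: $B_n(x,r)$ is the closed Euclidean ball in $\mathbb{R}^n$ with centre $x$ and radius $r$; $o$ is the origin; $B'_{d-1}(o,r)=B_{d-1}(o,r)\times\{0\}\subset\mathbb{R}^d$; $\mathbb{S}^{d-1}_+=\{s\in\mathbb{R}^d:\ s_1^2+\dots+s_d^2=1,\ s_d\ge 0\}$; $\oplus$ is Minkowski sum; $rK=\{rx:x\in K\}$; $\overline{A}$ is the closure of $A$; $\operatorname{sgn}:\mathbb{R}\to\{-1,0,1\}$ is the sign function. For $(z_1,\dots,z_{d-1})\in\{-1,1\}^{d-1}$, $$\mathcal{S}(z_1,\dots,z_{d-1})=\{s\in\mathbb{S}^{d-1}_+:\ \operatorname{sgn}(s_1)=z_1,\dots,\operatorname{sgn}(s_{d-1})=z_{d-1},\ s_d\ge 2/\sqrt5\}.$$ Cylinder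 model: for $\rho>0$ let $\eta_\rho=\{Y^{(1,\rho)},Y^{(2,\rho)},\dots\}$ be a homogeneous Poisson point process on $\mathbb{R}^{d-1}$ with intensity measure $\rho$ times Lebesgue measure. Let $\xi_\rho=\eta_\rho([0,1]^{d-1})$ and index the points so that $Y^{(1,\rho)},\dots,Y^{(\xi_\rho,\rho)}$ are those in $[0,1]^{d-1}$. Let $S^{(i,\rho)}$, $i\in\mathbb{N}$, be i.i.d. random vectors in $\mathbb{S}^{d-1}_+$ with law $\mathbb{Q}$ (not depending on $\rho$), independent of $\eta_\rho$. Put $X^{(i,\rho)}=\{(Y^{(i,\rho)},0)+tS^{(i,\rho)}:\ t\ge 0\}\subset\mathbb{R}^d$ and, for $K\subset\mathbb{R}^d$, $\mathcal{X}_\rho(K)=\bigcup_{i=1}^{\xi_\rho}\big(X^{(i,\rho)}\oplus K\big)$. The coverage radius is $R_\rho(K)=\inf\{r\ge 0:\ \mathcal{X}_\rho(rK)\supset[0,1]^d\}$, with $\inf\emptyset=\infty$. *)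

theory Defs
  imports "HOL-Probability.Probability"
begin

text \<open>
  With \<open>d - 1 = CARD('n)\<close>, the space \<open>R^(d-1)\<close> is \<open>real ^ 'n\<close> and \<open>R^d\<close> is the product
  \<open>(real ^ 'n) \<times> real\<close>, whose norm is the Euclidean one; the second component is the \<open>d\<close>-th
  coordinate. Since \<open>CARD('n) \<ge> 1\<close>, this is the case \<open>d \<ge> 2\<close>.
\<close>

abbreviation unit_cube :: "'a::euclidean_space set" where
  "unit_cube \<equiv> cbox 0 One"

definition upper_hemisphere :: "((real ^ 'n) \<times> real) set" where
  "upper_hemisphere = {s \<in> sphere 0 1. 0 \<le> snd s}"

definition orthant_directions :: "('n \<Rightarrow> real) \<Rightarrow> ((real ^ 'n) \<times> real) set" where
  "orthant_directions z =
     {s \<in> upper_hemisphere. (\<forall>i. sgn (fst s $ i) = z i) \<and> 2 / sqrt 5 \<le> snd s}"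

text \<open>
  A point process is a random measure \<open>N\<close>. The last axiom is the usual convention that a Poisson
  variable with infinite mean is almost surely infinite.
\<close>

locale poisson_process = prob_space M
  for M :: "'w measure" and N :: "'w \<Rightarrow> 'a measure" and \<Lambda> :: "'a measure" +
  assumes sets_N: "\<And>\<omega>. \<omega> \<in> space M \<Longrightarrow> sets (N \<omega>) = sets \<Lambda>"
    and random_variable_N:
      "\<And>A. A \<in> sets \<Lambda> \<Longrightarrow> (\<lambda>\<omega>. emeasure (N \<omega>) A) \<in> borel_measurable M"
    and indep_N:
      "\<And>(A :: nat \<Rightarrow> 'a set) n. (\<And>i. i < n \<Longrightarrow> A i \<in> sets \<Lambda>) \<Longrightarrow> disjoint_family_on A {..<n} \<Longrightarrow>
         indep_vars (\<lambda>_. borel) (\<lambda>i \<omega>. emeasure (N \<omega>) (A i)) {..<n}"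
    and poisson_N:
      "\<And>A k. A \<in> sets \<Lambda> \<Longrightarrow> emeasure \<Lambda> A < \<infinity> \<Longrightarrow>
         prob {\<omega> \<in> space M. emeasure (N \<omega>) A = of_nat k}
           = exp (- measure \<Lambda> A) * measure \<Lambda> A ^ k / fact k"
    and poisson_N_infinite:
      "\<And>A. A \<in> sets \<Lambda> \<Longrightarrow> emeasure \<Lambda> A = \<infinity> \<Longrightarrow> AE \<omega> in M. emeasure (N \<omega>) A = \<infinity>"

text \<open>
  The random counting measure of an enumerated family of random points: the measure of a Borel
  set \<open>A\<close> is the number of indices \<open>i\<close> with \<open>Y i \<omega> \<in> A\<close>.
\<close>

definition counting_process :: "(nat \<Rightarrow> 'w \<Rightarrow> 'a::topological_space) \<Rightarrow> 'w \<Rightarrow> 'a measure" where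
  "counting_process Y \<omega> = distr (count_space UNIV) borel (\<lambda>i. Y i \<omega>)"

definition cube_count :: "(nat \<Rightarrow> 'w \<Rightarrow> 'a::euclidean_space) \<Rightarrow> 'w \<Rightarrow> ennreal" where
  "cube_count Y \<omega> = emeasure (counting_process Y \<omega>) unit_cube"

text \<open>
  Indices start at \<open>0\<close>, so the points in the unit cube are those with index below the number of
  points there. Independence of the directions is required from the enumerated points, not merely
  from their counting measure: this excludes enumerations that are themselves chosen depending on
  the directions. It is stated for the generated sigma-algebras because the library's \<open>indep_var\<close>
  needs both variables to have the same type.
\<close>

locale cylinder_model = prob_space M
  for M :: "'w measure" and Q :: "((real ^ 'n) \<times> real) measure"
    and Y :: "real \<Rightarrow> nat \<Rightarrow> 'w \<Rightarrow> real ^ 'n"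
    and S :: "real \<Rightarrow> nat \<Rightarrow> 'w \<Rightarrow> (real ^ 'n) \<times> real" +
  assumes homogeneous_poisson:
      "\<And>\<rho>. 0 < \<rho> \<Longrightarrow> poisson_process M (counting_process (Y \<rho>)) (scale_measure (ennreal \<rho>) lborel)"
    and cube_points_first:
      "\<And>\<rho>. 0 < \<rho> \<Longrightarrow>
         AE \<omega> in M. \<forall>i. of_nat i < cube_count (Y \<rho>) \<omega> \<longleftrightarrow> Y \<rho> i \<omega> \<in> unit_cube"
    and directions_indep: "\<And>\<rho>. 0 < \<rho> \<Longrightarrow> indep_vars (\<lambda>_. Q) (S \<rho>) UNIV"
    and directions_law: "\<And>\<rho> i. 0 < \<rho> \<Longrightarrow> distr M Q (S \<rho> i) = Q"
    and points_indep_directions: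
      "\<And>\<rho>. 0 < \<rho> \<Longrightarrow>
         indep_set (sets (vimage_algebra (space M) (\<lambda>\<omega> i. Y \<rho> i \<omega>) (PiM UNIV (\<lambda>_. borel))))
           (sets (vimage_algebra (space M) (\<lambda>\<omega> i. S \<rho> i \<omega>) (PiM UNIV (\<lambda>_. Q))))"

definition ray :: "real ^ 'n \<Rightarrow> (real ^ 'n) \<times> real \<Rightarrow> ((real ^ 'n) \<times> real) set" where
  "ray y s = {(y, 0) + t *\<^sub>R s | t. 0 \<le> t}"

definition cylinder_union ::
  "(nat \<Rightarrow> 'w \<Rightarrow> real ^ 'n) \<Rightarrow> (nat \<Rightarrow> 'w \<Rightarrow> (real ^ 'n) \<times> real) \<Rightarrow>
     ((real ^ 'n) \<times> real) set \<Rightarrow> 'w \<Rightarrow> ((real ^ 'n) \<times> real) set" where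
  "cylinder_union Y S K \<omega> = (\<Union>i \<in> {i. of_nat i < cube_count Y \<omega>}. ray (Y i \<omega>) (S i \<omega>) + K)"

definition coverage_radius ::
  "(nat \<Rightarrow> 'w \<Rightarrow> real ^ 'n) \<Rightarrow> (nat \<Rightarrow> 'w \<Rightarrow> (real ^ 'n) \<times> real) \<Rightarrow>
     ((real ^ 'n) \<times> real) set \<Rightarrow> 'w \<Rightarrow> ereal" where
  "coverage_radius Y S K \<omega> =
     Inf {ereal r | r. 0 \<le> r \<and> unit_cube \<subseteq> cylinder_union Y S ((*\<^sub>R) r ` K) \<omega>}"

text \<open>
  The set \<open>K\<close> is arbitrary, so events concerning its coverage radius need not be measurable. Their
  probability is understood as inner probability, which agrees with the probability on every event
  that is measurable with respect to the completion.
\<close>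

definition inner_prob :: "'w measure \<Rightarrow> 'w set \<Rightarrow> real" where
  "inner_prob M A = (SUP B \<in> {B \<in> sets M. B \<subseteq> A}. measure M B)"

lemma inner_prob_completion:
  assumes "prob_space M" and A: "A \<in> sets (completion M)"
  shows "inner_prob M A = measure (completion M) A"
proof -
  interpret prob_space M by fact
  interpret C: prob_space "completion M"
    by (rule prob_spaceI) (simp add: emeasure_space_1)
  have main: "main_part M A \<in> sets M" "main_part M A \<subseteq> A"
    using A main_part_null_part_Un[OF A] by (blast intro: main_part_sets)+
  show ?thesis
    unfolding inner_prob_def
  proof (rule cSup_eq_maximum)
    have "measure (completion M) A = measure M (main_part M A)"
      using A by (simp add: measure_def)
    then show "measure (completion M) A \<in> measure M ` {B \<in> sets M. B \<subseteq> A}"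
      using main by auto
  next
    fix x assume "x \<in> measure M ` {B \<in> sets M. B \<subseteq> A}"
    then obtain B where B: "B \<in> sets M" "B \<subseteq> A" "x = measure M B" by auto
    then have "x = measure (completion M) B" by (simp add: measure_completion)
    also have "\<dots> \<le> measure (completion M) A" using B A by (intro C.finite_measure_mono) auto
    finally show "x \<le> measure (completion M) A" .
  qed
qed

lemma inner_prob_eq_measure:
  assumes "prob_space M" and "A \<in> sets M"
  shows "inner_prob M A = measure M A"
  using inner_prob_completion[OF assms(1)] assms(2) by (simp add: measure_completion)

end

theory Submission
  imports Defs "HOL-Real_Asymp.Real_Asymp"
begin

text \<open>
  Let \<open>n = d - 1\<close> and cut the base cube into cells of side \<open>1 / m\<close>, where \<open>1 / m\<close> is a constant
  times \<open>(ln \<rho> / \<rho>) powr (1 / n)\<close>. Then a cell contains of order \<open>ln \<rho>\<close> points, and at this scale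
  it suffices to know the cell of each point. Everything rests on one formula,
  \<open>prob_avoiding\<close>: the probability that no point in the cube has a direction in the set
  \<open>G c\<close> belonging to its cell \<open>c\<close> is the exponential of minus the sum over \<open>c\<close> of
  \<open>\<rho> vol(c) Q (G c)\<close>. It is obtained by conditioning on the finite list of cells of the
  enumerated points, which is independent of the directions, and then using that the counts in
  the cells are independent Poisson variables.

  Upper bound. A steep ray, of slope at most \<open>1 / 2\<close>, through a point \<open>(x, h)\<close> of the unit cube
  starts within distance \<open>1 / 2\<close> of \<open>x\<close>. If the signs of the direction are those of the
  orthant pointing from the centre of the cube towards \<open>x\<close>, it starts inside the cube. Such
  directions have probability at least \<open>p\<^sub>S\<close>, so the number of points whose cell and direction match
  this requirement is Poisson with mean at least \<open>\<rho> p\<^sub>S / m ^ n\<close>, a large multiple of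
  \<open>ln \<rho>\<close>. A union bound over a grid of at most \<open>\<rho>\<^sup>2\<close> points of the unit cube concludes
  (\<open>coverage_radius_le\<close>, \<open>coverage_radius_le_probable\<close>).

  Lower bound. Take well separated targets on the top face, where only rays of bounded slope are
  relevant. A direction reaches a given target from a bounded number of cells only, so for a
  suitable constant in the cell size each target stays uncovered with probability at least
  \<open>1 / sqrt \<rho>\<close>. The targets being separated, these events are pairwise independent, and as
  there are at least \<open>\<rho> / ln \<rho>\<close> of them, some target remains uncovered with high probability
  (\<open>coverage_radius_ge\<close>, \<open>second_moment_avoid\<close>, \<open>coverage_radius_ge_probable\<close>).
\<close>

section \<open>Poisson counts and pairwise independent events\<close>

text \<open>
  The power \<open>a ^ x\<close> of an extended count \<open>x\<close>, with the value \<open>0\<close> at infinity and at every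
  \<open>x\<close> that is not a natural number. Written as a series, it turns the expectation of
  \<open>a ^ N\<close> directly into a sum of point probabilities.
\<close>

definition power_count :: "real \<Rightarrow> ennreal \<Rightarrow> ennreal" where
  "power_count a x = (\<Sum>k. ennreal (a ^ k) * indicator {of_nat k} x)"

lemma power_count_of_nat: "power_count a (of_nat k) = ennreal (a ^ k)"
proof -
  have "(\<lambda>j. ennreal (a ^ j) * indicator {of_nat j} (of_nat k :: ennreal))
      = (\<lambda>j. if j = k then ennreal (a ^ k) else 0)"
    by (auto simp: indicator_def fun_eq_iff)
  then show ?thesis
    unfolding power_count_def using suminf_finite[of "{k}" "\<lambda>j. if j = k then ennreal (a ^ k) else 0"] by simp
qed

lemma power_count_measurable [measurable]: "power_count a \<in> borel_measurable borel"
  unfolding power_count_def by measurable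

context poisson_process
begin

lemma generating_function:
  assumes A: "A \<in> sets \<Lambda>" "emeasure \<Lambda> A < \<infinity>" and a: "0 \<le> a"
  shows "(\<integral>\<^sup>+\<omega>. power_count a (emeasure (N \<omega>) A) \<partial>M) = ennreal (exp (- (1 - a) * measure \<Lambda> A))"
proof -
  note [measurable] = random_variable_N[OF A(1)]
  let ?l = "measure \<Lambda> A"
  have "(\<integral>\<^sup>+\<omega>. power_count a (emeasure (N \<omega>) A) \<partial>M) =
     (\<Sum>k. \<integral>\<^sup>+\<omega>. ennreal (a ^ k) * indicator {of_nat k} (emeasure (N \<omega>) A) \<partial>M)"
    unfolding power_count_def by (rule nn_integral_suminf) measurable
  also have "\<dots> = (\<Sum>k. ennreal (exp (- ?l) * ((?l * a) ^ k /\<^sub>R fact k)))"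
  proof (rule suminf_cong)
    fix k
    have "(\<integral>\<^sup>+\<omega>. ennreal (a ^ k) * indicator {of_nat k} (emeasure (N \<omega>) A) \<partial>M) =
       (\<integral>\<^sup>+\<omega>. ennreal (a ^ k) * indicator {\<omega> \<in> space M. emeasure (N \<omega>) A = of_nat k} \<omega> \<partial>M)"
      by (intro nn_integral_cong) (auto simp: indicator_def)
    also have "\<dots> = ennreal (a ^ k) * emeasure M {\<omega> \<in> space M. emeasure (N \<omega>) A = of_nat k}"
      by (rule nn_integral_cmult_indicator) measurable
    also have "\<dots> = ennreal (exp (- ?l) * ((?l * a) ^ k /\<^sub>R fact k))"
      unfolding emeasure_eq_measure poisson_N[OF A]
      using a by (simp add: ennreal_mult'[symmetric] power_mult_distrib field_simps)
    finally show "(\<integral>\<^sup>+\<omega>. ennreal (a ^ k) * indicator {of_nat k} (emeasure (N \<omega>) A) \<partial>M) =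
       ennreal (exp (- ?l) * ((?l * a) ^ k /\<^sub>R fact k))" .
  qed
  also have "\<dots> = ennreal (exp (- ?l) * exp (?l * a))"
  proof -
    have s: "(\<lambda>k. exp (- ?l) * ((?l * a) ^ k /\<^sub>R fact k)) sums (exp (- ?l) * exp (?l * a))"
      by (intro sums_mult exp_converges)
    show ?thesis
      using s a by (subst suminf_ennreal2) (auto simp: sums_iff)
  qed
  also have "exp (- ?l) * exp (?l * a) = exp (- (1 - a) * ?l)"
    by (simp add: exp_add[symmetric] algebra_simps)
  finally show ?thesis .
qed

lemma AE_count_finite:
  assumes A: "A \<in> sets \<Lambda>" "emeasure \<Lambda> A < \<infinity>"
  shows "AE \<omega> in M. \<exists>k. emeasure (N \<omega>) A = of_nat k"
proof -
  note [measurable] = random_variable_N[OF A(1)]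
  let ?f = "\<lambda>\<omega>. power_count 1 (emeasure (N \<omega>) A)"
  let ?E = "{\<omega> \<in> space M. \<exists>k. emeasure (N \<omega>) A = of_nat k}"
  have "(\<integral>\<^sup>+\<omega>. ?f \<omega> \<partial>M) = (\<integral>\<^sup>+\<omega>. indicator ?E \<omega> \<partial>M)"
  proof (rule nn_integral_cong)
    fix \<omega> assume w: "\<omega> \<in> space M"
    show "?f \<omega> = indicator ?E \<omega>"
    proof (cases "\<omega> \<in> ?E")
      case True
      then show ?thesis by (auto simp: power_count_of_nat)
    next
      case False
      then show ?thesis using w by (simp add: power_count_def)
    qed
  qed
  then have "emeasure M ?E = 1"
    using generating_function[OF A, of 1] by simp
  then have "prob ?E = 1" by (simp add: emeasure_eq_measure)
  then show ?thesis by (subst (asm) prob_Collect_eq_1) measurable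
qed

text \<open>
  Over finitely many disjoint cells the counts are independent, so the generating functions
  multiply. This is where the Poisson assumption enters.
\<close>

lemma generating_function_prod:
  fixes cell :: "'c \<Rightarrow> 'a set"
  assumes C: "finite C" "disjoint_family_on cell C"
    and cell: "\<And>c. c \<in> C \<Longrightarrow> cell c \<in> sets \<Lambda>" "\<And>c. c \<in> C \<Longrightarrow> emeasure \<Lambda> (cell c) < \<infinity>"
    and a: "\<And>c. c \<in> C \<Longrightarrow> 0 \<le> a c"
  shows "(\<integral>\<^sup>+\<omega>. (\<Prod>c\<in>C. power_count (a c) (emeasure (N \<omega>) (cell c))) \<partial>M)
    = ennreal (exp (- (\<Sum>c\<in>C. (1 - a c) * measure \<Lambda> (cell c))))"
proof -
  obtain h where h: "bij_betw h {..<card C} C"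
    using C(1) bij_betw_from_nat_into_finite by blast
  have hC: "h i \<in> C" if "i < card C" for i using h that by (auto simp: bij_betw_def)
  have inj: "inj_on h {..<card C}" using h by (auto simp: bij_betw_def)
  have ind: "indep_vars (\<lambda>_. borel) (\<lambda>i \<omega>. emeasure (N \<omega>) (cell (h i))) {..<card C}"
  proof (rule indep_N)
    show "disjoint_family_on (\<lambda>i. cell (h i)) {..<card C}"
      using C(2) hC inj unfolding disjoint_family_on_def inj_on_def by (metis lessThan_iff)
  qed (use hC cell in auto)
  have "(\<integral>\<^sup>+\<omega>. (\<Prod>c\<in>C. power_count (a c) (emeasure (N \<omega>) (cell c))) \<partial>M)
    = (\<integral>\<^sup>+\<omega>. (\<Prod>i<card C. power_count (a (h i)) (emeasure (N \<omega>) (cell (h i)))) \<partial>M)"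
    by (simp add: prod.reindex_bij_betw[OF h, symmetric])
  also have "\<dots> = (\<Prod>i<card C. \<integral>\<^sup>+\<omega>. power_count (a (h i)) (emeasure (N \<omega>) (cell (h i))) \<partial>M)"
    by (rule indep_vars_nn_integral) (auto intro!: indep_vars_compose2[OF ind])
  also have "\<dots> = (\<Prod>i<card C. ennreal (exp (- (1 - a (h i)) * measure \<Lambda> (cell (h i)))))"
    using hC cell a by (intro prod.cong generating_function) auto
  also have "\<dots> = (\<Prod>c\<in>C. ennreal (exp (- (1 - a c) * measure \<Lambda> (cell c))))"
    by (rule prod.reindex_bij_betw[OF h])
  also have "\<dots> = ennreal (exp (- (\<Sum>c\<in>C. (1 - a c) * measure \<Lambda> (cell c))))"
    by (simp add: prod_ennreal exp_sum C(1) sum_negf[symmetric] left_diff_distrib)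
  finally show ?thesis .
qed

end

lemma emeasure_counting_process:
  assumes "A \<in> sets borel"
  shows "emeasure (counting_process Y \<omega>) A = emeasure (count_space UNIV) {i. Y i \<omega> \<in> A}"
  using assms unfolding counting_process_def
  by (subst emeasure_distr) (auto simp: vimage_def)

text \<open>
  Chebyshev's inequality for the number \<open>X\<close> of events that occur: pairwise independence bounds
  the variance of \<open>X\<close> by its expectation \<open>\<mu>\<close>, and \<open>X = 0\<close> forces \<open>(X - \<mu>)\<^sup>2 = \<mu>\<^sup>2\<close>.
\<close>

lemma (in prob_space) second_moment_avoid:
  assumes J: "finite J" and ev: "\<And>j. j \<in> J \<Longrightarrow> E j \<in> events"
    and pair: "\<And>j k. j \<in> J \<Longrightarrow> k \<in> J \<Longrightarrow> j \<noteq> k \<Longrightarrow> prob (E j \<inter> E k) = prob (E j) * prob (E k)"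
    and pos: "0 < (\<Sum>j\<in>J. prob (E j))"
  shows "prob (space M - (\<Union>j\<in>J. E j)) \<le> 1 / (\<Sum>j\<in>J. prob (E j))"
proof -
  define \<mu> where "\<mu> = (\<Sum>j\<in>J. prob (E j))"
  let ?X = "\<lambda>\<omega>. \<Sum>j\<in>J. indicator (E j) \<omega> - prob (E j)"
  let ?B = "space M - (\<Union>j\<in>J. E j)"
  have B: "?B \<in> events" using J ev by auto
  have int1: "integrable M (\<lambda>\<omega>. (indicator (E j) \<omega> - prob (E j)) * (indicator (E k) \<omega> - prob (E k)))" 
    if "j \<in> J" "k \<in> J" for j k
    using ev[OF that(1)] ev[OF that(2)]
    by (intro integrable_const_bound[where B=1])
       (auto simp: indicator_def abs_mult intro!: mult_le_one prob_le_1)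
  have e: "expectation (\<lambda>\<omega>. (indicator (E j) \<omega> - prob (E j)) * (indicator (E k) \<omega> - prob (E k)))
      = prob (E j \<inter> E k) - prob (E j) * prob (E k)" if jk: "j \<in> J" "k \<in> J" for j k
  proof -
    have i: "integrable M (indicator (E j) :: _ \<Rightarrow> real)" "integrable M (indicator (E k) :: _ \<Rightarrow> real)"
        "integrable M (indicator (E j \<inter> E k) :: _ \<Rightarrow> real)"
      using ev[OF jk(1)] ev[OF jk(2)] by (auto simp: less_top[symmetric])
    have "(\<lambda>\<omega>. (indicator (E j) \<omega> - prob (E j)) * (indicator (E k) \<omega> - prob (E k)))
      = (\<lambda>\<omega>. indicator (E j \<inter> E k) \<omega> - prob (E j) * indicator (E k) \<omega>
          - prob (E k) * indicator (E j) \<omega> + prob (E j) * prob (E k))"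
      by (auto simp: fun_eq_iff indicator_inter_arith algebra_simps)
    then show ?thesis
      using i ev[OF jk(1)] ev[OF jk(2)] by (simp add: prob_space)
  qed
  have sq: "(\<Sum>j\<in>J. f j)\<^sup>2 = (\<Sum>j\<in>J. \<Sum>k\<in>J. f j * f k)" for f :: "_ \<Rightarrow> real"
    by (simp add: power2_eq_square sum_product)
  have int2: "integrable M (\<lambda>\<omega>. (?X \<omega>)\<^sup>2)"
    unfolding sq by (intro Bochner_Integration.integrable_sum int1)
  have "\<mu>\<^sup>2 * prob ?B = expectation (\<lambda>\<omega>. \<mu>\<^sup>2 * indicator ?B \<omega>)"
    using B by simp
  also have "\<dots> \<le> expectation (\<lambda>\<omega>. (?X \<omega>)\<^sup>2)"
  proof (rule integral_mono)
    show "integrable M (\<lambda>\<omega>. \<mu>\<^sup>2 * indicator ?B \<omega>)" using B by (auto simp: less_top[symmetric])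
  next
    fix \<omega> assume "\<omega> \<in> space M"
    show "\<mu>\<^sup>2 * indicator ?B \<omega> \<le> (?X \<omega>)\<^sup>2"
    proof (cases "\<omega> \<in> ?B")
      case True
      then have "?X \<omega> = (\<Sum>j\<in>J. - prob (E j))" by (intro sum.cong) auto
      then show ?thesis using True by (simp add: \<mu>_def sum_negf)
    qed auto
  qed (rule int2)
  also have "\<dots> = (\<Sum>j\<in>J. \<Sum>k\<in>J. prob (E j \<inter> E k) - prob (E j) * prob (E k))"
    unfolding sq by (simp add: Bochner_Integration.integral_sum int1 e del: minus_apply)
  also have "\<dots> \<le> (\<Sum>j\<in>J. \<Sum>k\<in>J. if k = j then prob (E j) else 0)"
    using pair by (intro sum_mono) auto
  also have "\<dots> = \<mu>" using J by (simp add: \<mu>_def)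
  finally have "\<mu> * (\<mu> * prob ?B) \<le> \<mu> * 1" by (simp add: power2_eq_square)
  then show ?thesis using pos unfolding \<mu>_def[symmetric] by (simp add: field_simps)
qed

section \<open>Directions avoided by all points of the cube\<close>
text \<open>
  The list of cells visited by the points in the cube, in the order of enumeration, takes
  countably many values and depends on the enumerated points alone. Conditioning on this list
  replaces conditioning on the point process.
\<close>

lemma (in cylinder_model) sets_Y_sigma_cube_list:
  fixes \<kappa> :: "real ^ 'n \<Rightarrow> 'c::countable"
  assumes \<kappa> [measurable]: "\<kappa> \<in> borel \<rightarrow>\<^sub>M count_space UNIV"
  shows "{\<omega> \<in> space M. cube_count (Y \<rho>) \<omega> = of_nat (length l) \<and> (\<forall>i<length l. \<kappa> (Y \<rho> i \<omega>) = l ! i)}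
     \<in> sets (vimage_algebra (space M) (\<lambda>\<omega> i. Y \<rho> i \<omega>) (PiM UNIV (\<lambda>_. borel)))"
proof -
  let ?P = "PiM UNIV (\<lambda>_. borel) :: (nat \<Rightarrow> real ^ 'n) measure"
  let ?c = "\<lambda>f :: nat \<Rightarrow> real ^ 'n. \<Sum>i. indicator unit_cube (f i) :: ennreal"
  have cc: "cube_count (Y \<rho>) \<omega> = ?c (\<lambda>i. Y \<rho> i \<omega>)" for \<omega>
  proof -
    have "cube_count (Y \<rho>) \<omega> = (\<integral>\<^sup>+i. indicator {i. Y \<rho> i \<omega> \<in> unit_cube} i \<partial>count_space UNIV)"
      by (simp add: cube_count_def emeasure_counting_process)
    also have "\<dots> = (\<Sum>i. indicator {i. Y \<rho> i \<omega> \<in> unit_cube} i)"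
      by (rule nn_integral_count_space_nat)
    finally show ?thesis by (simp add: indicator_def)
  qed
  let ?A = "{f \<in> space ?P. ?c f = of_nat (length l) \<and> (\<forall>i<length l. \<kappa> (f i) = l ! i)}"
  have [measurable]: "(unit_cube :: (real ^ 'n) set) \<in> sets borel" by simp
  have "?A \<in> sets ?P" by measurable
  from in_vimage_algebra[OF this, of "\<lambda>\<omega> i. Y \<rho> i \<omega>" "space M"]
  show ?thesis
    by (rule back_subst[where P="\<lambda>A. A \<in> _"]) (auto simp: cc space_PiM)
qed

lemma (in cylinder_model) S_measurable: "0 < \<rho> \<Longrightarrow> S \<rho> i \<in> M \<rightarrow>\<^sub>M Q"
  using directions_indep[of \<rho>] by (auto simp: indep_vars_def)

lemma (in cylinder_model) points_measurable:
  assumes "0 < \<rho>"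
  shows "Y \<rho> i \<in> borel_measurable M"
proof (rule measurableI)
  fix A :: "(real ^ 'n) set" assume [measurable]: "A \<in> sets borel"
  let ?P = "PiM UNIV (\<lambda>_. borel) :: (nat \<Rightarrow> real ^ 'n) measure"
  have "{f \<in> space ?P. f i \<in> A} \<in> sets ?P" by measurable
  from in_vimage_algebra[OF this, of "\<lambda>\<omega> i. Y \<rho> i \<omega>" "space M"]
  have "Y \<rho> i -` A \<inter> space M \<in> sets (vimage_algebra (space M) (\<lambda>\<omega> i. Y \<rho> i \<omega>) ?P)"
    by (rule back_subst[where P="\<lambda>A. A \<in> _"]) (auto simp: space_PiM)
  then show "Y \<rho> i -` A \<inter> space M \<in> events"
    using indep_setD_ev1[OF points_indep_directions[OF assms]] by blast
qed simp

text \<open>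
  Once the list of cells is fixed, the directions are independent draws from \<open>Q\<close>, each of which
  has to miss one prescribed set.
\<close>

lemma (in cylinder_model) directions_avoid:
  assumes \<rho>: "0 < \<rho>" and Q: "prob_space Q"
    and G: "\<And>i. i < m \<Longrightarrow> G i \<in> sets Q"
  shows "{\<omega> \<in> space M. \<forall>i<m. S \<rho> i \<omega> \<notin> G i}
      \<in> sets (vimage_algebra (space M) (\<lambda>\<omega> i. S \<rho> i \<omega>) (PiM UNIV (\<lambda>_. Q)))" (is "?E \<in> ?A")
    and "prob {\<omega> \<in> space M. \<forall>i<m. S \<rho> i \<omega> \<notin> G i} = (\<Prod>i<m. 1 - measure Q (G i))"
proof -
  interpret Q: prob_space Q by fact
  note S [measurable] = S_measurable[OF \<rho>]
  have SQ: "S \<rho> i \<omega> \<in> space Q" if "\<omega> \<in> space M" for i \<omega>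
    using S that by (rule measurable_space)
  let ?P = "PiM UNIV (\<lambda>_. Q) :: (nat \<Rightarrow> _) measure"
  have "{f \<in> space ?P. \<forall>i<m. f i \<notin> G i} \<in> sets ?P"
  proof -
    have "{f \<in> space ?P. f i \<notin> G i} \<in> sets ?P" if "i < m" for i
    proof -
      note [measurable] = G[OF that]
      show ?thesis by measurable
    qed
    moreover have "{f \<in> space ?P. \<forall>i<m. f i \<notin> G i} = {f \<in> space ?P. \<forall>i\<in>{..<m}. f i \<notin> G i}" by auto
    ultimately show ?thesis by (auto intro!: sets.sets_Collect_finite_All')
  qed
  from in_vimage_algebra[OF this, of "\<lambda>\<omega> i. S \<rho> i \<omega>" "space M"]
  show "?E \<in> ?A"
    by (rule back_subst[where P="\<lambda>A. A \<in> _"]) (auto simp: SQ space_PiM)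
  show "prob ?E = (\<Prod>i<m. 1 - measure Q (G i))"
  proof (cases "m = 0")
    case True
    then show ?thesis by (simp add: prob_space)
  next
    case False
    have "?E = (\<Inter>i\<in>{..<m}. S \<rho> i -` (space Q - G i) \<inter> space M)"
      using False SQ by auto
    then have "prob ?E = (\<Prod>i\<in>{..<m}. prob (S \<rho> i -` (space Q - G i) \<inter> space M))"
      using False G by (simp only:) (intro indep_varsD[OF directions_indep[OF \<rho>]], auto)
    also have "\<dots> = (\<Prod>i<m. 1 - measure Q (G i))"
    proof (intro prod.cong refl)
      fix i assume "i \<in> {..<m}"
      then have i: "G i \<in> sets Q" using G by auto
      have "prob (S \<rho> i -` (space Q - G i) \<inter> space M) = measure (distr M Q (S \<rho> i)) (space Q - G i)"
        using i by (subst measure_distr) auto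
      then show "prob (S \<rho> i -` (space Q - G i) \<inter> space M) = 1 - measure Q (G i)"
        using i by (simp add: directions_law[OF \<rho>] Q.prob_compl)
    qed
    finally show ?thesis .
  qed
qed

context cylinder_model
begin

text \<open>
  The set \<open>G c\<close> consists of the directions that are forbidden to points in the cell \<open>c\<close>; the cells
  are the fibres of \<open>\<kappa>\<close>.
\<close>

definition avoiding :: "real \<Rightarrow> (real ^ 'n \<Rightarrow> 'c) \<Rightarrow> ('c \<Rightarrow> ((real ^ 'n) \<times> real) set) \<Rightarrow> 'w set" where
  "avoiding \<rho> \<kappa> G =
     {\<omega> \<in> space M. \<forall>i. of_nat i < cube_count (Y \<rho>) \<omega> \<longrightarrow> S \<rho> i \<omega> \<notin> G (\<kappa> (Y \<rho> i \<omega>))}"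

lemma cube_count_finite:
  assumes \<rho>: "0 < \<rho>"
  shows "AE \<omega> in M. \<exists>k. cube_count (Y \<rho>) \<omega> = of_nat k"
proof -
  interpret P: poisson_process M "counting_process (Y \<rho>)" "scale_measure (ennreal \<rho>) lborel"
    by (rule homogeneous_poisson[OF \<rho>])
  show ?thesis
    using P.AE_count_finite[of unit_cube]
    by (simp add: cube_count_def ennreal_mult_less_top less_top[symmetric])
qed

text \<open>
  This is the void probability of the marked Poisson process on the region
  \<open>{(y, s). s \<in> G (\<kappa> y)}\<close>. Given the list of visited cells, a point in cell \<open>c\<close> avoids \<open>G c\<close> with
  probability \<open>q c = 1 - Q (G c)\<close>, so the conditional probability is the product of the
  \<open>q c\<close> to the power of the number of points in \<open>c\<close>. Its expectation is a product of generating
  functions of independent Poisson variables.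
\<close>

lemma
  fixes \<kappa> :: "real ^ 'n \<Rightarrow> 'c::countable"
  assumes \<rho>: "0 < \<rho>" and Q: "prob_space Q"
    and \<kappa> [measurable]: "\<kappa> \<in> borel \<rightarrow>\<^sub>M count_space UNIV"
    and C: "finite C" "\<And>y. y \<in> unit_cube \<Longrightarrow> \<kappa> y \<in> C"
    and G: "\<And>c. G c \<in> sets Q"
  shows sets_avoiding: "avoiding \<rho> \<kappa> G \<in> events"
    and prob_avoiding: "prob (avoiding \<rho> \<kappa> G) =
        exp (- \<rho> * (\<Sum>c\<in>C. measure lborel {y \<in> unit_cube. \<kappa> y = c} * measure Q (G c)))"
proof -
  interpret Q: prob_space Q by fact
  interpret P: poisson_process M "counting_process (Y \<rho>)" "scale_measure (ennreal \<rho>) lborel"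
    by (rule homogeneous_poisson[OF \<rho>])
  note S [measurable] = S_measurable[OF \<rho>]
  define q where "q c = 1 - measure Q (G c)" for c
  have q0: "0 \<le> q c" for c by (simp add: q_def)
  define cell where "cell c = {y \<in> unit_cube. \<kappa> y = c}" for c
  have cell [measurable]: "cell c \<in> sets borel" for c
  proof -
    have "cell c = {y \<in> space borel. \<kappa> y = c} \<inter> unit_cube" by (auto simp: cell_def)
    then show ?thesis by simp
  qed
  have fin: "emeasure lborel (cell c) < \<infinity>" for c
  proof -
    have "emeasure lborel (cell c) \<le> emeasure lborel (unit_cube :: (real ^ 'n) set)"
      by (rule emeasure_mono) (auto simp: cell_def)
    also have "\<dots> < \<infinity>" by (simp add: emeasure_lborel_cbox_finite)
    finally show ?thesis .
  qed
  \<comment> \<open>\<open>E l\<close>: the list of visited cells is \<open>l\<close>; \<open>F l\<close>: the directions obey the constraints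
      that come with \<open>l\<close>. The two are independent, and \<open>E\<close> almost surely partitions the space.\<close>
  define E where "E l = {\<omega> \<in> space M. cube_count (Y \<rho>) \<omega> = of_nat (length l) \<and>
      (\<forall>i<length l. \<kappa> (Y \<rho> i \<omega>) = l ! i)}" for l
  define F where "F l = {\<omega> \<in> space M. \<forall>i<length l. S \<rho> i \<omega> \<notin> G (l ! i)}" for l
  note E_Y = sets_Y_sigma_cube_list[OF \<kappa>, of \<rho>, folded E_def]
  have E_ev [measurable]: "E l \<in> events" for l
    using E_Y[of l] indep_setD_ev1[OF points_indep_directions[OF \<rho>]] by blast
  have F_S: "F l \<in> sets (vimage_algebra (space M) (\<lambda>\<omega> i. S \<rho> i \<omega>) (PiM UNIV (\<lambda>_. Q)))" for l
    unfolding F_def by (intro directions_avoid(1)[OF \<rho> Q] G)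
  have F_prob: "prob (F l) = (\<Prod>i<length l. q (l ! i))" for l
    unfolding F_def q_def by (intro directions_avoid(2)[OF \<rho> Q] G)
  have F_ev [measurable]: "F l \<in> events" for l
    using F_S[of l] indep_setD_ev2[OF points_indep_directions[OF \<rho>]] by blast
  have EF: "prob (E l \<inter> F l) = prob (E l) * (\<Prod>i<length l. q (l ! i))" for l
    using indep_setD[OF points_indep_directions[OF \<rho>] E_Y F_S] F_prob by simp

  have cc_meas [measurable]: "cube_count (Y \<rho>) \<in> borel_measurable M"
    using P.random_variable_N[of unit_cube] by (simp add: cube_count_def[abs_def])
  have Y_meas: "Measurable.pred M (\<lambda>\<omega>. S \<rho> i \<omega> \<notin> G (\<kappa> (Y \<rho> i \<omega>)))" for i
  proof (rule measurable_compose_countable[where f = "\<lambda>c \<omega>. S \<rho> i \<omega> \<notin> G c" and g = "\<lambda>\<omega>. \<kappa> (Y \<rho> i \<omega>)"])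
    fix c
    note [measurable] = G[of c]
    show "Measurable.pred M (\<lambda>\<omega>. S \<rho> i \<omega> \<notin> G c)" by measurable
  next
    show "(\<lambda>\<omega>. \<kappa> (Y \<rho> i \<omega>)) \<in> M \<rightarrow>\<^sub>M count_space UNIV"
      using points_measurable[OF \<rho>, of i] by measurable
  qed
  show ev: "avoiding \<rho> \<kappa> G \<in> events"
    unfolding avoiding_def using Y_meas by measurable

  define g where "g l = (\<Prod>i<length l. q (l ! i))" for l
  have E_iff: "\<omega> \<in> E l' \<longleftrightarrow> l' = l" if "\<omega> \<in> E l" for \<omega> l l'
    using that unfolding E_def by (auto intro!: nth_equalityI)
  have ae: "AE \<omega> in M. \<exists>l. \<omega> \<in> E l \<and>
      (\<forall>i. i < length l \<longleftrightarrow> Y \<rho> i \<omega> \<in> unit_cube)"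
    using cube_count_finite[OF \<rho>] cube_points_first[OF \<rho>] AE_space
  proof eventually_elim
    fix \<omega> assume "\<exists>k. cube_count (Y \<rho>) \<omega> = of_nat k"
      and i: "\<forall>i. of_nat i < cube_count (Y \<rho>) \<omega> \<longleftrightarrow> Y \<rho> i \<omega> \<in> unit_cube" and w: "\<omega> \<in> space M"
    then obtain k where k: "cube_count (Y \<rho>) \<omega> = of_nat k" by auto
    then show "\<exists>l. \<omega> \<in> E l \<and> (\<forall>i. i < length l \<longleftrightarrow> Y \<rho> i \<omega> \<in> unit_cube)"
      using i w by (intro exI[of _ "map (\<lambda>i. \<kappa> (Y \<rho> i \<omega>)) [0..<k]"]) (auto simp: E_def)
  qed
  have count: "(\<Prod>c\<in>C. power_count (q c) (emeasure (counting_process (Y \<rho>) \<omega>) (cell c))) = ennreal (g l)"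
    if l: "\<omega> \<in> E l" "\<forall>i. i < length l \<longleftrightarrow> Y \<rho> i \<omega> \<in> unit_cube" for \<omega> l
  proof -
    have lC: "l ! i \<in> C" if "i < length l" for i
      using l that C(2) unfolding E_def by force
    have "emeasure (counting_process (Y \<rho>) \<omega>) (cell c) = of_nat (card {i \<in> {..<length l}. l ! i = c})" for c
    proof -
      have "{i. Y \<rho> i \<omega> \<in> cell c} = {i \<in> {..<length l}. l ! i = c}"
        using l by (auto simp: cell_def E_def)
      then show ?thesis by (simp add: emeasure_counting_process emeasure_count_space)
    qed
    then have "(\<Prod>c\<in>C. power_count (q c) (emeasure (counting_process (Y \<rho>) \<omega>) (cell c)))
        = ennreal (\<Prod>c\<in>C. \<Prod>i | i \<in> {..<length l} \<and> l ! i = c. q (l ! i))"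
      by (simp add: power_count_of_nat prod_ennreal q0)
    also have "(\<Prod>c\<in>C. \<Prod>i | i \<in> {..<length l} \<and> l ! i = c. q (l ! i)) = g l"
      unfolding g_def using C(1) lC by (intro prod.group) auto
    finally show ?thesis .
  qed
  have "emeasure M (avoiding \<rho> \<kappa> G) = (\<integral>\<^sup>+\<omega>. indicator (avoiding \<rho> \<kappa> G) \<omega> \<partial>M)"
    using ev by simp
  \<comment> \<open>Split according to the list, use independence in each part, and reassemble: the sum over
      lists of \<open>g l\<close> times the probability of \<open>E l\<close> is the expectation of \<open>g\<close> at the random list.\<close>
  also have "\<dots> = (\<integral>\<^sup>+\<omega>. (\<integral>\<^sup>+l. indicator (E l \<inter> F l) \<omega> \<partial>count_space UNIV) \<partial>M)"
    using ae AE_space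
  proof (intro nn_integral_cong_AE, eventually_elim)
    fix \<omega> assume "\<exists>l. \<omega> \<in> E l \<and> (\<forall>i. i < length l \<longleftrightarrow> Y \<rho> i \<omega> \<in> unit_cube)"
      and w: "\<omega> \<in> space M"
    then obtain l where l: "\<omega> \<in> E l" by auto
    have "(\<lambda>l'. indicator (E l' \<inter> F l') \<omega> :: ennreal) = (\<lambda>l'. indicator (F l) \<omega> * indicator {l} l')"
      by (auto simp: fun_eq_iff indicator_def E_iff[OF l])
    moreover have "indicator (avoiding \<rho> \<kappa> G) \<omega> = (indicator (F l) \<omega> :: ennreal)"
      using l by (auto simp: avoiding_def E_def F_def indicator_def)
    ultimately show "(indicator (avoiding \<rho> \<kappa> G) \<omega> :: ennreal)
        = (\<integral>\<^sup>+l. indicator (E l \<inter> F l) \<omega> \<partial>count_space UNIV)"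
      by (simp add: nn_integral_cmult_indicator)
  qed
  also have "\<dots> = (\<integral>\<^sup>+l. (\<integral>\<^sup>+\<omega>. indicator (E l \<inter> F l) \<omega> \<partial>M) \<partial>count_space UNIV)"
    by (rule nn_integral_count_space_nn_integral) auto
  also have "\<dots> = (\<integral>\<^sup>+l. (\<integral>\<^sup>+\<omega>. ennreal (g l) * indicator (E l) \<omega> \<partial>M) \<partial>count_space UNIV)"
  proof (rule nn_integral_cong)
    fix l :: "'c list"
    have "(\<integral>\<^sup>+\<omega>. indicator (E l \<inter> F l) \<omega> \<partial>M) = emeasure M (E l \<inter> F l)"
      by (intro nn_integral_indicator) measurable
    moreover have "(\<integral>\<^sup>+\<omega>. ennreal (g l) * indicator (E l) \<omega> \<partial>M) = ennreal (g l) * emeasure M (E l)"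
      by (intro nn_integral_cmult_indicator) measurable
    ultimately show "(\<integral>\<^sup>+\<omega>. indicator (E l \<inter> F l) \<omega> \<partial>M) = (\<integral>\<^sup>+\<omega>. ennreal (g l) * indicator (E l) \<omega> \<partial>M)"
      by (simp add: emeasure_eq_measure EF g_def ennreal_mult'[symmetric] prod_nonneg q0 mult.commute)
  qed
  also have "\<dots> = (\<integral>\<^sup>+\<omega>. (\<integral>\<^sup>+l. ennreal (g l) * indicator (E l) \<omega> \<partial>count_space UNIV) \<partial>M)"
    by (rule nn_integral_count_space_nn_integral[symmetric]) auto
  also have "\<dots> = (\<integral>\<^sup>+\<omega>. (\<Prod>c\<in>C. power_count (q c) (emeasure (counting_process (Y \<rho>) \<omega>) (cell c))) \<partial>M)"
    using ae
  proof (intro nn_integral_cong_AE, eventually_elim)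
    fix \<omega> assume "\<exists>l. \<omega> \<in> E l \<and> (\<forall>i. i < length l \<longleftrightarrow> Y \<rho> i \<omega> \<in> unit_cube)"
    then obtain l where l: "\<omega> \<in> E l" "\<forall>i. i < length l \<longleftrightarrow> Y \<rho> i \<omega> \<in> unit_cube" by auto
    have "(\<lambda>l'. ennreal (g l') * indicator (E l') \<omega> :: ennreal) = (\<lambda>l'. ennreal (g l) * indicator {l} l')"
      by (auto simp: fun_eq_iff indicator_def E_iff[OF l(1)])
    then show "(\<integral>\<^sup>+l. ennreal (g l) * indicator (E l) \<omega> \<partial>count_space UNIV) =
        (\<Prod>c\<in>C. power_count (q c) (emeasure (counting_process (Y \<rho>) \<omega>) (cell c)))"
      by (simp add: nn_integral_cmult_indicator count[OF l])
  qed
  also have "\<dots> = ennreal (exp (- (\<Sum>c\<in>C. (1 - q c) * measure (scale_measure (ennreal \<rho>) lborel) (cell c))))"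
    using C(1) q0 fin cell
    by (intro P.generating_function_prod) (auto simp: disjoint_family_on_def cell_def ennreal_mult_less_top)
  also have "(\<Sum>c\<in>C. (1 - q c) * measure (scale_measure (ennreal \<rho>) lborel) (cell c))
      = \<rho> * (\<Sum>c\<in>C. measure lborel (cell c) * measure Q (G c))"
    using \<rho> by (simp add: q_def measure_scale_measure sum_distrib_left mult_ac)
  finally show "prob (avoiding \<rho> \<kappa> G) =
        exp (- \<rho> * (\<Sum>c\<in>C. measure lborel {y \<in> unit_cube. \<kappa> y = c} * measure Q (G c)))"
    by (simp add: emeasure_eq_measure cell_def)
qed

end

section \<open>The grid\<close>

lemma One_vec_nth: "(One :: real ^ 'n) $ i = 1"
proof -
  have "(One :: real ^ 'n) \<bullet> axis i 1 = 1"
    by (rule inner_sum_Basis) (auto simp: Basis_vec_def)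
  then show ?thesis by (simp add: inner_axis)
qed

lemma unit_cube_vec_iff: "(x :: real ^ 'n) \<in> unit_cube \<longleftrightarrow> (\<forall>i. 0 \<le> x $ i \<and> x $ i \<le> 1)"
  unfolding mem_box_cart by (simp only: One_vec_nth zero_index)

lemma unit_cube_Pair_iff:
  "((x, h) :: (real ^ 'n) \<times> real) \<in> unit_cube \<longleftrightarrow> x \<in> unit_cube \<and> 0 \<le> h \<and> h \<le> 1"
proof -
  have *: "(One :: (real ^ 'n) \<times> real) \<bullet> b = 1" if "b \<in> Basis" for b
    using that by (rule inner_sum_Basis)
  show ?thesis
    using * by (force simp: mem_box Basis_prod_def ball_Un inner_sum_Basis)
qed

lemma norm_vec_le_card:
  fixes x :: "real ^ 'n"
  assumes "\<And>i. \<bar>x $ i\<bar> \<le> e"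
  shows "norm x \<le> real CARD('n) * e"
proof -
  have "norm x \<le> (\<Sum>i\<in>UNIV. \<bar>x $ i\<bar>)" by (rule norm_le_l1_cart)
  also have "\<dots> \<le> real CARD('n) * e" using assms by (rule sum_bounded_above)
  finally show ?thesis .
qed

text \<open>
  The cube is cut into \<open>m\<close> slices of width \<open>1 / m\<close> in each coordinate. The minimum puts the right
  end point \<open>t = 1\<close> into the last slice.
\<close>

definition grid_coord :: "nat \<Rightarrow> real \<Rightarrow> nat" where
  "grid_coord m t = min (nat \<lfloor>real m * t\<rfloor>) (m - 1)"

definition grid_cell :: "nat \<Rightarrow> real ^ 'n \<Rightarrow> 'n \<Rightarrow> nat" where
  "grid_cell m y = (\<lambda>i. grid_coord m (y $ i))"

definition grid_indices :: "nat \<Rightarrow> ('n::finite \<Rightarrow> nat) set" where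
  "grid_indices m = {c. \<forall>i. c i < m}"

definition grid_point :: "nat \<Rightarrow> ('n::finite \<Rightarrow> nat) \<Rightarrow> real ^ 'n" where
  "grid_point m c = (\<chi> i. real (c i) / real m)"

lemma grid_coord_less: "0 < m \<Longrightarrow> grid_coord m t < m"
  by (auto simp: grid_coord_def)

lemma grid_coord_bounds:
  assumes m: "0 < m" and t: "0 \<le> t" "t \<le> 1"
  shows "real (grid_coord m t) / real m \<le> t" "t \<le> (real (grid_coord m t) + 1) / real m"
proof -
  define k where "k = nat \<lfloor>real m * t\<rfloor>"
  have k: "real k \<le> real m * t" "real m * t < real k + 1"
    unfolding k_def using t by (auto simp: of_nat_nat)
  have mt: "real m * t \<le> real m" using t m by (simp add: mult_left_le)
  have c: "grid_coord m t = min k (m - 1)" by (simp add: grid_coord_def k_def)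
  have "real (grid_coord m t) \<le> real m * t" using k c by linarith
  then show "real (grid_coord m t) / real m \<le> t" using m by (simp add: field_simps)
  have "real m * t \<le> real (grid_coord m t) + 1"
  proof (cases "k \<le> m - 1")
    case True
    then show ?thesis using k c by simp
  next
    case False
    then show ?thesis using mt c m by (simp add: of_nat_diff)
  qed
  then show "t \<le> (real (grid_coord m t) + 1) / real m" using m by (simp add: field_simps)
qed

lemma grid_coord_eqI:
  assumes "k < m" "real k / real m \<le> t" "t < (real k + 1) / real m"
  shows "grid_coord m t = k"
proof -
  have "real k \<le> real m * t" "real m * t < real k + 1"
    using assms by (auto simp: field_simps)
  then have "\<lfloor>real m * t\<rfloor> = int k" by (intro floor_unique) auto
  then show ?thesis using assms by (simp add: grid_coord_def)
qed

lemma finite_grid_indices: "finite (grid_indices m :: ('n::finite \<Rightarrow> nat) set)"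
  and card_grid_indices: "card (grid_indices m :: ('n::finite \<Rightarrow> nat) set) = m ^ CARD('n)"
proof -
  have *: "(grid_indices m :: ('n::finite \<Rightarrow> nat) set) = (\<Pi>\<^sub>E i\<in>UNIV. {..<m})"
    by (auto simp: grid_indices_def PiE_def)
  show "finite (grid_indices m :: ('n::finite \<Rightarrow> nat) set)"
    unfolding * by (rule finite_PiE) auto
  show "card (grid_indices m :: ('n::finite \<Rightarrow> nat) set) = m ^ CARD('n)"
    unfolding * by (subst card_PiE) auto
qed

lemma grid_cell_in: "0 < m \<Longrightarrow> grid_cell m y \<in> grid_indices m"
  by (auto simp: grid_cell_def grid_indices_def grid_coord_less)

lemma grid_cell_measurable [measurable]: "grid_cell m \<in> borel \<rightarrow>\<^sub>M count_space UNIV"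
proof -
  have 1: "{y :: real ^ 'n. grid_cell m y = c} = {y \<in> space borel. \<forall>i\<in>UNIV. grid_coord m (y $ i) = c i}" for c
    by (auto simp: grid_cell_def)
  have "{y :: real ^ 'n. grid_cell m y = c} \<in> sets borel" for c
    unfolding 1 grid_coord_def by (intro sets.sets_Collect_finite_All) (auto, measurable)
  then show ?thesis
    by (auto simp: measurable_count_space_eq2_countable vimage_def)
qed

lemma grid_point_nth [simp]: "grid_point m c $ i = real (c i) / real m"
  by (simp add: grid_point_def)

lemma grid_cell_near:
  fixes y :: "real ^ 'n"
  assumes "0 < m" "y \<in> unit_cube"
  shows "0 \<le> y $ i - grid_point m (grid_cell m y) $ i"
    and "y $ i - grid_point m (grid_cell m y) $ i \<le> 1 / real m"
  using grid_coord_bounds[OF assms(1), of "y $ i"] assms(2)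
  by (auto simp: unit_cube_vec_iff grid_cell_def add_divide_distrib)

lemma grid_point_in_cube:
  assumes "c \<in> grid_indices m"
  shows "grid_point m c \<in> unit_cube"
  using assms by (auto simp: unit_cube_vec_iff grid_indices_def less_imp_le divide_le_eq)

lemma measure_grid_cell:
  assumes m: "0 < m" and c: "c \<in> grid_indices m"
  shows "measure lborel {y :: real ^ 'n \<in> unit_cube. grid_cell m y = c} = 1 / real m ^ CARD('n)"
proof -
  let ?C = "{y :: real ^ 'n \<in> unit_cube. grid_cell m y = c}"
  let ?a = "grid_point m c" and ?b = "grid_point m (\<lambda>i. c i + 1)"
  have le: "?a \<bullet> b \<le> ?b \<bullet> b" if "b \<in> Basis" for b
    using that by (auto simp: Basis_vec_def inner_axis divide_right_mono)
  have pr: "(\<Prod>b\<in>Basis. (?b - ?a) \<bullet> b) = 1 / real m ^ CARD('n)"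
  proof -
    have "(\<Prod>b\<in>Basis. (?b - ?a) \<bullet> b) = (\<Prod>b\<in>(Basis :: (real ^ 'n) set). 1 / real m)"
      by (intro prod.cong) (auto simp: Basis_vec_def inner_axis add_divide_distrib)
    then show ?thesis by (simp add: power_one_over)
  qed
  have C: "?C \<in> sets lborel"
  proof -
    have "?C = {y \<in> space borel. grid_cell m y = c} \<inter> unit_cube" by auto
    then show ?thesis by simp
  qed
  have "box ?a ?b \<subseteq> ?C"
  proof
    fix y assume y: "y \<in> box ?a ?b"
    then have b: "real (c i) / real m < y $ i" "y $ i < (real (c i) + 1) / real m" for i
      by (auto simp: mem_box_cart add.commute)
    have "grid_cell m y = c"
      using b c by (auto simp: grid_cell_def grid_indices_def fun_eq_iff intro!: grid_coord_eqI less_imp_le)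
    moreover have "y \<in> unit_cube"
      unfolding unit_cube_vec_iff
    proof (intro allI conjI)
      fix i
      show "0 \<le> y $ i" using b(1)[of i] m by (smt (verit) divide_nonneg_nonneg of_nat_0_le_iff)
      have "c i < m" using c by (simp add: grid_indices_def)
      then have "real (c i) + 1 \<le> real m" by linarith
      then have "(real (c i) + 1) / real m \<le> 1" using m by simp
      then show "y $ i \<le> 1" using b(2)[of i] by linarith
    qed
    ultimately show "y \<in> ?C" by auto
  qed
  then have "measure lborel (box ?a ?b) \<le> measure lborel ?C"
    using C by (intro measure_mono_fmeasurable) (auto simp: fmeasurable_def intro: le_less_trans[OF emeasure_mono[of _ "unit_cube"]])
  moreover have "?C \<subseteq> cbox ?a ?b"
  proof
    fix y assume y: "y \<in> ?C"
    then show "y \<in> cbox ?a ?b"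
      using grid_cell_near[OF m, of y] by (auto simp: mem_box_cart add_divide_distrib algebra_simps)
  qed
  then have "measure lborel ?C \<le> measure lborel (cbox ?a ?b)"
    using C by (intro measure_mono_fmeasurable) auto
  ultimately show ?thesis
    using le pr by (simp add: measure_lborel_box_eq measure_lborel_cbox_eq)
qed

section \<open>Geometry of the rays\<close>

definition slope :: "(real ^ 'n) \<times> real \<Rightarrow> real ^ 'n" where
  "slope s = fst s /\<^sub>R snd s"

definition steep_directions :: "('n \<Rightarrow> real) \<Rightarrow> ((real ^ 'n) \<times> real) set" where
  "steep_directions z =
     {s \<in> upper_hemisphere. (\<forall>i. 0 \<le> z i * fst s $ i) \<and> 2 / sqrt 5 \<le> snd s}"

text \<open>
  A coordinate in the unit interval can be moved by up to \<open>1 / 2\<close> in the direction of the centre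
  without leaving the interval. Going down along a ray subtracts its slope, so the slope must
  have the opposite signs.
\<close>

definition away_from_centre :: "real ^ 'n \<Rightarrow> 'n \<Rightarrow> real" where
  "away_from_centre x i = (if x $ i \<le> 1 / 2 then - 1 else 1)"

lemma closed_upper_hemisphere: "closed (upper_hemisphere :: ((real ^ 'n) \<times> real) set)"
proof -
  have "(upper_hemisphere :: ((real ^ 'n) \<times> real) set) = sphere 0 1 \<inter> {s. 0 \<le> snd s}"
    by (auto simp: upper_hemisphere_def)
  moreover have "closed \<dots>" by (intro closed_Int closed_Collect_le continuous_intros closed_sphere)
  ultimately show ?thesis by simp
qed

lemma closed_steep_directions: "closed (steep_directions z :: ((real ^ 'n) \<times> real) set)"
proof -
  have "(steep_directions z :: ((real ^ 'n) \<times> real) set) =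
      upper_hemisphere \<inter> (\<Inter>i. {s. 0 \<le> z i * fst s $ i}) \<inter> {s. 2 / sqrt 5 \<le> snd s}"
    by (auto simp: steep_directions_def)
  then show ?thesis
    by (auto intro!: closed_Int closed_INT closed_Collect_le continuous_intros closed_upper_hemisphere)
qed

text \<open>
  The closed set on the right is easier to handle than the closure itself, and only a lower
  bound on its probability is needed.
\<close>

lemma closure_orthant_subset_steep:
  "closure (orthant_directions z) \<subseteq> steep_directions z"
proof (rule closure_minimal)
  have "0 \<le> z i * t" if "sgn t = z i" for t i
    unfolding that[symmetric] by (simp add: sgn_if)
  then show "orthant_directions z \<subseteq> steep_directions z"
    unfolding orthant_directions_def steep_directions_def by blast
qed (rule closed_steep_directions)

text \<open>
  The height \<open>2 / \<surd>5\<close> is the one at which a unit vector has slope exactly \<open>1 / 2\<close>.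
\<close>

lemma steep_slope:
  assumes "s \<in> steep_directions z"
  shows "0 < snd s" "norm (slope s) \<le> 1 / 2"
proof -
  have s: "norm s = 1" "2 / sqrt 5 \<le> snd s"
    using assms by (auto simp: steep_directions_def upper_hemisphere_def)
  have p: "0 < 2 / sqrt (5::real)" by simp
  show pos: "0 < snd s" using s(2) p by linarith
  have "(2 / sqrt 5)\<^sup>2 \<le> (snd s)\<^sup>2" using s(2) p by (intro power_mono) auto
  then have "4 / 5 \<le> (snd s)\<^sup>2" by (simp add: power_divide)
  moreover have "(norm (fst s))\<^sup>2 + (snd s)\<^sup>2 = 1"
    using s(1) by (cases s) (simp add: norm_Pair)
  ultimately have "(norm (fst s))\<^sup>2 \<le> (snd s / 2)\<^sup>2" by (simp add: power_divide)
  then have "norm (fst s) \<le> snd s / 2" using pos by (simp add: power2_le_iff_abs_le)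
  then show "norm (slope s) \<le> 1 / 2" using pos by (simp add: slope_def field_simps)
qed

text \<open>
  A ray with the chosen direction that passes through \<open>(x, h)\<close> starts inside the cube: the
  shift has length at most \<open>1 / 2\<close> and points towards the centre in each coordinate.
\<close>

lemma shifted_point_in_cube:
  assumes x: "x \<in> unit_cube" and h: "0 \<le> h" "h \<le> 1"
    and s: "s \<in> steep_directions (away_from_centre x)"
  shows "x - h *\<^sub>R slope s \<in> unit_cube"
  unfolding unit_cube_vec_iff
proof
  fix i
  note st = steep_slope[OF s]
  have "\<bar>slope s $ i\<bar> \<le> 1 / 2" using st(2) component_le_norm_cart[of "slope s" i] by linarith
  then have b: "\<bar>h * slope s $ i\<bar> \<le> 1 / 2"
    using mult_mono[of "\<bar>h\<bar>" 1 "\<bar>slope s $ i\<bar>" "1/2"] h by (simp add: abs_mult)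
  have x': "0 \<le> x $ i" "x $ i \<le> 1" using x by (auto simp: unit_cube_vec_iff)
  have z: "0 \<le> away_from_centre x i * fst s $ i" using s by (auto simp: steep_directions_def)
  show "0 \<le> (x - h *\<^sub>R slope s) $ i \<and> (x - h *\<^sub>R slope s) $ i \<le> 1"
  proof (cases "x $ i \<le> 1 / 2")
    case True
    then have "fst s $ i \<le> 0" using z by (simp add: away_from_centre_def)
    then have "h * slope s $ i \<le> 0" using h st(1)
      by (auto simp: slope_def mult_nonneg_nonpos mult_nonpos_nonneg divide_le_0_iff)
    then show ?thesis using True b x' by auto
  next
    case False
    then have "0 \<le> fst s $ i" using z by (simp add: away_from_centre_def)
    then have "0 \<le> h * slope s $ i" using h st(1) by (simp add: slope_def)
    then show ?thesis using False b x' by auto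
  qed
qed

lemma in_ray_plus:
  assumes "0 < snd s" "0 \<le> h" "(x - y - h *\<^sub>R slope s, 0) \<in> K"
  shows "(x, h) \<in> ray y s + K"
proof -
  have "(x, h) = ((y, 0) + (h / snd s) *\<^sub>R s) + (x - y - h *\<^sub>R slope s, 0)"
    using assms(1) by (cases s) (simp add: slope_def divide_inverse)
  moreover have "(y, 0) + (h / snd s) *\<^sub>R s \<in> ray y s"
    unfolding ray_def using assms by (intro CollectI exI[of _ "h / snd s"]) auto
  ultimately show ?thesis using assms(3) by (metis set_plus_intro)
qed

text \<open>
  It suffices to look at the \<open>m ^ d\<close> grid points \<open>(x', h')\<close> of the unit cube. Suppose that each
  is assigned a point \<open>Y\<close> with a steep direction of slope \<open>v\<close> such that \<open>Y\<close> lies in the same cell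
  as \<open>x' - h' v\<close>. For arbitrary \<open>(x, h)\<close> with lower grid neighbour \<open>(x', h')\<close>, the ray of \<open>Y\<close> then
  passes at height \<open>h\<close> within coordinate distance \<open>3 / m\<close> of \<open>x\<close>: the errors are \<open>1 / m\<close> from
  \<open>x\<close>, \<open>1 / m\<close> from \<open>Y\<close> and \<open>1 / (2 m)\<close> from the change of height. The flat ball inside \<open>K\<close>
  bridges this distance horizontally.
\<close>

lemma coverage_radius_le:
  fixes K :: "((real ^ 'n) \<times> real) set"
  assumes m: "0 < m" and r: "0 < r" "cball 0 r \<times> {0} \<subseteq> K"
    and hit: "\<And>c k. c \<in> grid_indices m \<Longrightarrow> k < m \<Longrightarrow>
      \<exists>i. of_nat i < cube_count Y \<omega> \<and> Y i \<omega> \<in> unit_cube \<and>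
        S i \<omega> \<in> steep_directions (away_from_centre (grid_point m c)) \<and>
        grid_cell m (Y i \<omega>) = grid_cell m (grid_point m c - (real k / real m) *\<^sub>R slope (S i \<omega>))"
  shows "coverage_radius Y S K \<omega> \<le> ereal (3 * real CARD('n) / (r * real m))"
proof -
  let ?R = "3 * real CARD('n) / (r * real m)"
  have R: "0 < ?R" using m r by simp
  have "unit_cube \<subseteq> cylinder_union Y S ((*\<^sub>R) ?R ` K) \<omega>"
  proof (rule subrelI)
    fix x :: "real ^ 'n" and h :: real assume "(x, h) \<in> unit_cube"
    then have x: "x \<in> unit_cube" and h: "0 \<le> h" "h \<le> 1" by (auto simp: unit_cube_Pair_iff)
    define c where "c = grid_cell m x"
    define k where "k = grid_coord m h"
    have ck: "c \<in> grid_indices m" "k < m"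
      using m by (auto simp: c_def k_def grid_cell_in grid_coord_less)
    from hit[OF this] obtain i where i: "of_nat i < cube_count Y \<omega>" "Y i \<omega> \<in> unit_cube"
        "S i \<omega> \<in> steep_directions (away_from_centre (grid_point m c))"
        "grid_cell m (Y i \<omega>) = grid_cell m (grid_point m c - (real k / real m) *\<^sub>R slope (S i \<omega>))"
      by blast
    define v where "v = slope (S i \<omega>)"
    define p where "p = grid_point m c - (real k / real m) *\<^sub>R v"
    have p: "p \<in> unit_cube"
      unfolding p_def v_def using grid_point_in_cube[OF ck(1)] ck(2) i(3)
      by (intro shifted_point_in_cube) auto
    have cellp: "grid_cell m (Y i \<omega>) = grid_cell m p" using i(4) by (simp add: p_def v_def)
    \<comment> \<open>the gap at height \<open>h\<close> between \<open>x\<close> and the ray\<close>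
    define w where "w = x - Y i \<omega> - h *\<^sub>R v"
    have "\<bar>w $ j\<bar> \<le> 3 / real m" for j
    proof -
      have 1: "\<bar>x $ j - grid_point m c $ j\<bar> \<le> 1 / real m"
        using grid_cell_near[OF m x, of j] unfolding c_def by linarith
      have 2: "\<bar>p $ j - Y i \<omega> $ j\<bar> \<le> 1 / real m"
        using grid_cell_near[OF m p, of j] grid_cell_near[OF m i(2), of j] unfolding cellp by linarith
      have 3: "\<bar>h - real k / real m\<bar> \<le> 1 / real m"
        using grid_coord_bounds[OF m h] unfolding k_def by (simp add: add_divide_distrib)
      have 4: "\<bar>v $ j\<bar> \<le> 1 / 2"
        using steep_slope(2)[OF i(3)] component_le_norm_cart[of v j] unfolding v_def by linarith
      have 5: "\<bar>(h - real k / real m) * v $ j\<bar> \<le> 1 / real m * (1 / 2)"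
        unfolding abs_mult using 3 4 by (intro mult_mono) auto
      have "w $ j = (x $ j - grid_point m c $ j) + (p $ j - Y i \<omega> $ j) - (h - real k / real m) * v $ j"
        by (simp add: w_def p_def algebra_simps)
      then have "\<bar>w $ j\<bar> \<le> \<bar>x $ j - grid_point m c $ j\<bar> + \<bar>p $ j - Y i \<omega> $ j\<bar>
          + \<bar>(h - real k / real m) * v $ j\<bar>"
        by (metis abs_triangle_ineq abs_triangle_ineq4 add_right_mono order_trans)
      also have "\<dots> \<le> 1 / real m + 1 / real m + 1 / real m * (1 / 2)"
        using 1 2 5 by (intro add_mono)
      also have "\<dots> \<le> 3 / real m" using m by (simp add: field_simps)
      finally show ?thesis .
    qed
    then have "norm w \<le> real CARD('n) * (3 / real m)" by (rule norm_vec_le_card)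
    moreover have "r * ?R = real CARD('n) * (3 / real m)" using r(1) by simp
    ultimately have "norm w / ?R \<le> r" by (simp only: pos_divide_le_eq[OF R])
    moreover have "norm (w /\<^sub>R ?R) = norm w / ?R"
      unfolding norm_scaleR abs_inverse abs_of_pos[OF R] by (simp only: divide_inverse mult.commute)
    ultimately have "norm (w /\<^sub>R ?R) \<le> r" by (simp only:)
    then have "(w /\<^sub>R ?R, 0) \<in> K" using r(2) by auto
    moreover have "(w, 0) = ?R *\<^sub>R (w /\<^sub>R ?R, 0 :: real)" using m r(1) by simp
    ultimately have "(w, 0) \<in> (*\<^sub>R) ?R ` K" by (metis imageI)
    then have "(x, h) \<in> ray (Y i \<omega>) (S i \<omega>) + (*\<^sub>R) ?R ` K"
      using steep_slope(1)[OF i(3)] h(1) unfolding w_def v_def by (intro in_ray_plus)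
    then show "(x, h) \<in> cylinder_union Y S ((*\<^sub>R) ?R ` K) \<omega>"
      using i(1) unfolding cylinder_union_def by blast
  qed
  then show ?thesis
    unfolding coverage_radius_def using R by (intro Inf_lower) auto
qed

text \<open>
  The directions with which a ray from the cell \<open>c\<close> may come close to \<open>(w, 1)\<close>. The point is
  taken on the top face because nearly horizontal rays, each of which could cover a long strip
  of the bottom face, leave the vicinity of the cube before they reach height \<open>1\<close>.
\<close>

definition reaching_directions :: "nat \<Rightarrow> real ^ 'n \<Rightarrow> ('n \<Rightarrow> nat) \<Rightarrow> ((real ^ 'n) \<times> real) set" where
  "reaching_directions m w c = {s \<in> upper_hemisphere. 0 < snd s \<and>
     (\<forall>i. \<bar>real (c i) / real m + slope s $ i - w $ i\<bar> \<le> 2 / real m)}"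

text \<open>
  If a cylinder covers \<open>(w, 1)\<close>, then its axis is within \<open>e = R L \<le> 1 / 4\<close> of that point, so it has
  height at least \<open>1 / 2\<close> there, while its horizontal displacement is at most \<open>n + 1 / 2\<close>. This bounds the slope by \<open>2 n + 1\<close>, where \<open>n = CARD('n)\<close>, and moving along the axis to
  height exactly \<open>1\<close> costs at most \<open>e (2 n + 1)\<close> more.
\<close>

lemma covered_imp_reaching:
  fixes w y :: "real ^ 'n"
  assumes m: "0 < m" and R: "0 \<le> R" and K: "K \<subseteq> cball 0 L" and L: "0 \<le> L"
    and small: "(2 * real CARD('n) + 2) * (R * L) \<le> 1 / real m"
    and w: "w \<in> unit_cube" and y: "y \<in> unit_cube" and s: "s \<in> upper_hemisphere"
    and cov: "(w, 1) \<in> ray y s + (*\<^sub>R) R ` K"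
  shows "s \<in> reaching_directions m w (grid_cell m y)"
proof -
  let ?n = "real CARD('n)"
  define e where "e = R * L"
  have n1: "1 \<le> ?n" by (simp add: Suc_leI)
  have m1: "1 / real m \<le> 1" using m by simp
  have e0: "0 \<le> e" using R L by (simp add: e_def)
  have "4 * e \<le> (2 * ?n + 2) * e" using n1 e0 by (intro mult_right_mono) auto
  then have e: "e \<le> 1 / 2" using small m1 unfolding e_def[symmetric] by linarith
  from cov obtain t k where t: "0 \<le> t" and k: "k \<in> K" and eq: "(w, 1) = (y, 0) + t *\<^sub>R s + R *\<^sub>R k"
    by (auto simp: ray_def elim!: set_plus_elim)
  define a where "a = t * snd s"
  have "norm (R *\<^sub>R k) \<le> e" using k K R by (auto simp: e_def intro!: mult_left_mono)
  then have nk: "norm (fst (R *\<^sub>R k)) \<le> e" "\<bar>snd (R *\<^sub>R k)\<bar> \<le> e"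
    using norm_fst_le[of "fst (R *\<^sub>R k)" "snd (R *\<^sub>R k)"] norm_snd_le[of "snd (R *\<^sub>R k)" "fst (R *\<^sub>R k)"]
    unfolding prod.collapse real_norm_def by (blast intro: order_trans)+
  have e1: "w - y - t *\<^sub>R fst s = fst (R *\<^sub>R k)" and e2: "1 - a = snd (R *\<^sub>R k)"
    using arg_cong[OF eq, of fst] arg_cong[OF eq, of snd] by (auto simp: a_def)
  have a: "\<bar>1 - a\<bar> \<le> e" using nk(2) e2 by simp
  then have a2: "1 / 2 \<le> a" using e by linarith
  then have "0 < t * snd s" by (simp add: a_def)
  then have sd: "0 < snd s" using t by (simp add: zero_less_mult_iff)
  define v where "v = slope s"
  have av: "t *\<^sub>R fst s = a *\<^sub>R v" using sd by (simp add: a_def v_def slope_def)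
  have wy: "norm (w - y) \<le> ?n * 1"
  proof (rule norm_vec_le_card)
    fix i show "\<bar>(w - y) $ i\<bar> \<le> 1"
      using w y unfolding unit_cube_vec_iff by (smt (verit) vector_minus_component)
  qed
  have n3: "norm (w - y - a *\<^sub>R v) \<le> e" using nk(1) e1 av by simp
  have "a * norm v = norm ((w - y) - (w - y - a *\<^sub>R v))" using a2 by simp
  also have "\<dots> \<le> ?n + 1 / 2" using wy n3 e norm_triangle_ineq4[of "w - y" "w - y - a *\<^sub>R v"] by linarith
  finally have "a * norm v \<le> ?n + 1 / 2" .
  moreover have "1 / 2 * norm v \<le> a * norm v" using a2 by (intro mult_right_mono) auto
  ultimately have nv: "norm v \<le> 2 * ?n + 1" by linarith
  have "norm (y + v - w) = norm ((1 - a) *\<^sub>R v - (w - y - a *\<^sub>R v))" by (simp add: algebra_simps)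
  also have "\<dots> \<le> \<bar>1 - a\<bar> * norm v + norm (w - y - a *\<^sub>R v)"
    using norm_triangle_ineq4[of "(1 - a) *\<^sub>R v" "w - y - a *\<^sub>R v"] by simp
  also have "\<dots> \<le> e * (2 * ?n + 1) + e" using a nv n3 e0 by (intro add_mono mult_mono) auto
  also have "\<dots> = (2 * ?n + 2) * (R * L)" by (simp add: e_def algebra_simps)
  finally have "norm (y + v - w) \<le> 1 / real m" using small by linarith
  then have "\<bar>(y + v - w) $ i\<bar> \<le> 1 / real m" for i
    using component_le_norm_cart[of "y + v - w" i] by linarith
  then have "\<bar>real (grid_cell m y i) / real m + v $ i - w $ i\<bar> \<le> 2 / real m" for i
  proof -
    have "\<bar>(y + v - w) $ i\<bar> \<le> 1 / real m" by fact
    moreover have "2 / real m = 2 * (1 / real m)" by simp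
    ultimately show ?thesis using grid_cell_near[OF m y, of i] by simp
  qed
  then show ?thesis using s sd by (auto simp: reaching_directions_def v_def)
qed

lemma coverage_radius_ge:
  fixes w :: "real ^ 'n"
  assumes m: "0 < m" and K: "K \<subseteq> cball 0 L" and L: "0 \<le> L" and R0: "0 \<le> R0"
    and small: "(2 * real CARD('n) + 2) * (R0 * L) \<le> 1 / real m"
    and w: "w \<in> unit_cube"
    and pts: "\<And>i. of_nat i < cube_count Y \<omega> \<Longrightarrow> Y i \<omega> \<in> unit_cube \<and> S i \<omega> \<in> upper_hemisphere"
    and avoid: "\<And>i. of_nat i < cube_count Y \<omega> \<Longrightarrow>
       S i \<omega> \<notin> reaching_directions m w (grid_cell m (Y i \<omega>))"
  shows "ereal R0 \<le> coverage_radius Y S K \<omega>"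
  unfolding coverage_radius_def
proof (rule Inf_greatest)
  fix b assume "b \<in> {ereal r | r. 0 \<le> r \<and> unit_cube \<subseteq> cylinder_union Y S ((*\<^sub>R) r ` K) \<omega>}"
  then obtain R :: real where b: "b = ereal R" and R: "0 \<le> R"
    and cov: "unit_cube \<subseteq> cylinder_union Y S ((*\<^sub>R) R ` K) \<omega>" by blast
  have "(w, 1 :: real) \<in> unit_cube" using w by (simp add: unit_cube_Pair_iff)
  then obtain i where i: "of_nat i < cube_count Y \<omega>" "(w, 1) \<in> ray (Y i \<omega>) (S i \<omega>) + (*\<^sub>R) R ` K"
    using cov unfolding cylinder_union_def by blast
  show "ereal R0 \<le> b"
    unfolding b
  proof (rule ccontr)
    assume "\<not> ereal R0 \<le> ereal R"
    then have "R * L \<le> R0 * L" using L by (intro mult_right_mono) auto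
    then have "(2 * real CARD('n) + 2) * (R * L) \<le> (2 * real CARD('n) + 2) * (R0 * L)"
      by (intro mult_left_mono) auto
    then have "(2 * real CARD('n) + 2) * (R * L) \<le> 1 / real m" using small by linarith
    then show False
      using covered_imp_reaching[OF m R K L _ w _ _ i(2)] pts[OF i(1)] avoid[OF i(1)] by blast
  qed
qed

text \<open>
  In each coordinate the cell index lies in a real interval of length \<open>4\<close>, hence takes at most
  five values.
\<close>

lemma card_reaching_cells:
  fixes w :: "real ^ 'n"
  assumes m: "0 < m"
  shows "card {c \<in> grid_indices m. s \<in> reaching_directions m w c} \<le> 5 ^ CARD('n)"
proof -
  define f where "f i = \<lfloor>real m * (w $ i - slope s $ i)\<rfloor>" for i
  let ?P = "\<Pi>\<^sub>E i\<in>UNIV. {f i - 2 .. f i + 2}"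
  have "card {c \<in> grid_indices m. s \<in> reaching_directions m w c} \<le> card ?P"
  proof (rule card_inj_on_le[where f = "\<lambda>c i. int (c i)"])
    show "inj_on (\<lambda>c i. int (c i)) {c \<in> grid_indices m. s \<in> reaching_directions m w c}"
      by (auto simp: inj_on_def fun_eq_iff)
    have "int (c i) \<in> {f i - 2 .. f i + 2}" if c: "s \<in> reaching_directions m w c" for c i
    proof -
      have "\<bar>real (c i) / real m + slope s $ i - w $ i\<bar> \<le> 2 / real m"
        using c by (auto simp: reaching_directions_def)
      then have "real m * \<bar>real (c i) / real m + slope s $ i - w $ i\<bar> \<le> 2"
        using m by (simp add: field_simps)
      then have "\<bar>real m * (real (c i) / real m + slope s $ i - w $ i)\<bar> \<le> 2"
        by (simp add: abs_mult)
      moreover have "real m * (real (c i) / real m + slope s $ i - w $ i)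
          = real (c i) - real m * (w $ i - slope s $ i)"
        using m by (simp add: field_simps)
      ultimately have "\<bar>real (c i) - real m * (w $ i - slope s $ i)\<bar> \<le> 2" by simp
      then show ?thesis unfolding f_def by simp linarith
    qed
    then show "(\<lambda>c i. int (c i)) ` {c \<in> grid_indices m. s \<in> reaching_directions m w c} \<subseteq> ?P"
      by (auto simp: PiE_def)
    show "finite ?P" by (rule finite_PiE) auto
  qed
  also have "card ?P = 5 ^ CARD('n)" by (simp add: card_PiE)
  finally show ?thesis .
qed

section \<open>Both bounds hold with high probability\<close>

lemma sets_hemisphere_iff:
  assumes "sets Q = sets (restrict_space borel (upper_hemisphere :: ((real ^ 'n) \<times> real) set))"
  shows "A \<in> sets Q \<longleftrightarrow> A \<subseteq> upper_hemisphere \<and> A \<in> sets borel"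
  unfolding assms using borel_closed[OF closed_upper_hemisphere] by (subst sets_restrict_space_iff) auto

lemma slope_measurable [measurable]: "slope \<in> borel_measurable borel"
proof -
  have [measurable]: "(fst :: (real ^ 'n) \<times> real \<Rightarrow> _) \<in> borel_measurable borel"
      "(snd :: (real ^ 'n) \<times> real \<Rightarrow> _) \<in> borel_measurable borel"
    by (intro borel_measurable_continuous_onI continuous_intros)+
  show ?thesis unfolding slope_def[abs_def] by measurable
qed

lemma sets_reaching_directions: "reaching_directions m w c \<in> sets borel"
proof -
  have [measurable]: "(snd :: (real ^ 'n) \<times> real \<Rightarrow> _) \<in> borel_measurable borel"
    by (intro borel_measurable_continuous_onI continuous_intros)
  have "reaching_directions m w c = upper_hemisphere \<inter> {s \<in> space borel. 0 < snd s} \<inter>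
     {s \<in> space borel. \<forall>i\<in>UNIV. \<bar>real (c i) / real m + slope s $ i - w $ i\<bar> \<le> 2 / real m}"
    by (auto simp: reaching_directions_def)
  also have "\<dots> \<in> sets borel"
    using borel_closed[OF closed_upper_hemisphere]
    by (intro sets.Int sets.sets_Collect_finite_All) (auto, measurable)
  finally show ?thesis .
qed

text \<open>
  The steep directions whose ray through \<open>(x, h)\<close> starts in the cell \<open>c\<close>. For fixed \<open>x\<close> and \<open>h\<close>,
  these sets partition the steep directions as \<open>c\<close> varies.
\<close>

definition aiming_directions ::
    "nat \<Rightarrow> real ^ 'n \<Rightarrow> real \<Rightarrow> ('n \<Rightarrow> nat) \<Rightarrow> ((real ^ 'n) \<times> real) set" where
  "aiming_directions m x h c =
     {s \<in> steep_directions (away_from_centre x). grid_cell m (x - h *\<^sub>R slope s) = c}"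

lemma sets_aiming_directions: "aiming_directions m x h c \<in> sets borel"
proof -
  have "aiming_directions m x h c =
      steep_directions (away_from_centre x) \<inter> {s \<in> space borel. grid_cell m (x - h *\<^sub>R slope s) = c}"
    by (auto simp: aiming_directions_def)
  also have "\<dots> \<in> sets borel"
    using borel_closed[OF closed_steep_directions] by (intro sets.Int) auto
  finally show ?thesis .
qed

lemma (in prob_space) sum_prob_le_multiplicity:
  assumes C: "finite C" and G: "\<And>c. c \<in> C \<Longrightarrow> G c \<in> events"
    and mult: "\<And>s. s \<in> space M \<Longrightarrow> card {c \<in> C. s \<in> G c} \<le> k"
  shows "(\<Sum>c\<in>C. prob (G c)) \<le> real k"
proof -
  have int: "integrable M (indicator (G c) :: _ \<Rightarrow> real)" if "c \<in> C" for c
    using G[OF that] by (auto simp: less_top[symmetric])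
  have "(\<Sum>c\<in>C. prob (G c)) = (\<integral>s. (\<Sum>c\<in>C. indicator (G c) s) \<partial>M)"
    using G int by (subst Bochner_Integration.integral_sum) auto
  also have "\<dots> \<le> (\<integral>s. real k \<partial>M)"
  proof (rule integral_mono)
    fix s assume s: "s \<in> space M"
    have "(\<Sum>c\<in>C. indicator (G c) s) = real (card {c \<in> C. s \<in> G c})"
      using C by (simp add: indicator_def sum.If_cases Collect_conj_eq)
    then show "(\<Sum>c\<in>C. indicator (G c) s) \<le> real k" using mult[OF s] by simp
  qed (use int in auto)
  finally show ?thesis by (simp add: prob_space)
qed

context cylinder_model
begin

lemma prob_avoiding_grid:
  fixes G :: "('n \<Rightarrow> nat) \<Rightarrow> ((real ^ 'n) \<times> real) set"
  assumes \<rho>: "0 < \<rho>" and Q: "prob_space Q" and m: "0 < m" and G: "\<And>c. G c \<in> sets Q"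
  shows "prob (avoiding \<rho> (grid_cell m) G) =
    exp (- \<rho> / real m ^ CARD('n) * (\<Sum>c\<in>grid_indices m. measure Q (G c)))"
proof -
  have "prob (avoiding \<rho> (grid_cell m) G) =
     exp (- \<rho> * (\<Sum>c\<in>grid_indices m. 1 / real m ^ CARD('n) * measure Q (G c)))"
    by (subst prob_avoiding[OF \<rho> Q grid_cell_measurable finite_grid_indices])
       (auto simp: G grid_cell_in[OF m] measure_grid_cell[OF m] intro!: sum.cong)
  then show ?thesis by (simp add: sum_divide_distrib[symmetric])
qed

lemma sets_avoiding_grid:
  fixes G :: "('n \<Rightarrow> nat) \<Rightarrow> ((real ^ 'n) \<times> real) set"
  assumes \<rho>: "0 < \<rho>" and Q: "prob_space Q" and m: "0 < m" and G: "\<And>c. G c \<in> sets Q"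
  shows "avoiding \<rho> (grid_cell m) G \<in> events"
  by (rule sets_avoiding[OF \<rho> Q grid_cell_measurable finite_grid_indices[of m]]) (auto simp: G grid_cell_in[OF m])

text \<open>
  The complement of \<open>E\<close>, reduced by the null set on which the enumeration does not list the
  points of the cube first.
\<close>

lemma probable_good_points:
  assumes \<rho>: "0 < \<rho>" and bad: "E \<in> events"
  obtains B where "B \<in> events" "1 - prob E \<le> prob B" "B \<inter> E = {}"
    "\<And>\<omega> i. \<omega> \<in> B \<Longrightarrow> of_nat i < cube_count (Y \<rho>) \<omega> \<Longrightarrow> Y \<rho> i \<omega> \<in> unit_cube"
proof -
  from cube_points_first[OF \<rho>] obtain N where N: "N \<in> events" "emeasure M N = 0"
    "{\<omega> \<in> space M. \<not> (\<forall>i. of_nat i < cube_count (Y \<rho>) \<omega> \<longleftrightarrow> Y \<rho> i \<omega> \<in> unit_cube)} \<subseteq> N"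
    by (rule AE_E) auto
  let ?B = "space M - (E \<union> N)"
  have "prob (E \<union> N) \<le> prob E + prob N" using bad N(1) by (rule measure_Un_le)
  then have "1 - prob E \<le> prob ?B"
    using N bad by (subst prob_compl) (auto simp: measure_def)
  moreover have "of_nat i < cube_count (Y \<rho>) \<omega> \<Longrightarrow> Y \<rho> i \<omega> \<in> unit_cube" if "\<omega> \<in> ?B" for \<omega> i
    using that N(3) by blast
  ultimately show thesis using N(1) bad by (intro that[of ?B]) auto
qed

text \<open>
  A union bound over the \<open>m ^ (CARD('n) + 1)\<close> grid points. For a single one, the aiming
  directions of the different cells are disjoint with union the steep directions, so the
  exponents of the void probability add up to at least \<open>\<rho> p / m ^ CARD('n)\<close>.
\<close>

lemma coverage_radius_le_probable:
  fixes K :: "((real ^ 'n) \<times> real) set" and p :: real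
  assumes \<rho>: "0 < \<rho>" and Q: "prob_space Q" and sQ: "sets Q = sets (restrict_space borel upper_hemisphere)"
    and m: "0 < m" and r: "0 < r" "cball 0 r \<times> {0} \<subseteq> K"
    and p: "\<And>z :: 'n \<Rightarrow> real. (\<forall>i. z i \<in> {-1, 1}) \<Longrightarrow> p \<le> measure Q (steep_directions z)"
  obtains B where "B \<in> events"
    "1 - real m ^ (CARD('n) + 1) * exp (- \<rho> * p / real m ^ CARD('n)) \<le> prob B"
    "\<And>\<omega>. \<omega> \<in> B \<Longrightarrow> coverage_radius (Y \<rho>) (S \<rho>) K \<omega> \<le> ereal (3 * real CARD('n) / (r * real m))"
proof -
  interpret Q: prob_space Q by fact
  let ?T = "grid_indices m \<times> {..<m} :: (('n \<Rightarrow> nat) \<times> nat) set"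
  define G where "G = (\<lambda>(c :: 'n \<Rightarrow> nat, k :: nat). aiming_directions m (grid_point m c) (real k / real m))"
  have GQ: "G t c \<in> sets Q" for t c
    unfolding sets_hemisphere_iff[OF sQ] G_def
    using sets_aiming_directions by (auto simp: aiming_directions_def steep_directions_def split: prod.split)
  define E where "E = (\<Union>t\<in>?T. avoiding \<rho> (grid_cell m) (G t))"
  have fT: "finite ?T" using finite_grid_indices by auto
  have ev: "avoiding \<rho> (grid_cell m) (G t) \<in> events" for t
    by (rule sets_avoiding_grid[OF \<rho> Q m]) (rule GQ)
  have Eev: "E \<in> events" unfolding E_def using fT ev by auto
  have one: "prob (avoiding \<rho> (grid_cell m) (G t)) \<le> exp (- \<rho> * p / real m ^ CARD('n))" for t
  proof -
    obtain c k where t: "t = (c, k)" by (cases t)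
    let ?st = "steep_directions (away_from_centre (grid_point m c))"
    have "p \<le> measure Q ?st" by (rule p) (simp add: away_from_centre_def)
    also have "?st = (\<Union>c'\<in>grid_indices m. G t c')"
      using grid_cell_in[OF m] by (auto simp: G_def t aiming_directions_def)
    also have "measure Q \<dots> = (\<Sum>c'\<in>grid_indices m. measure Q (G t c'))"
      using GQ by (intro Q.finite_measure_finite_Union finite_grid_indices)
        (auto simp: disjoint_family_on_def G_def t aiming_directions_def)
    finally have "\<rho> / real m ^ CARD('n) * p \<le> \<rho> / real m ^ CARD('n) * (\<Sum>c'\<in>grid_indices m. measure Q (G t c'))"
      using \<rho> by (intro mult_left_mono) auto
    then show ?thesis by (simp add: prob_avoiding_grid[OF \<rho> Q m GQ])
  qed
  have "prob E \<le> (\<Sum>t\<in>?T. prob (avoiding \<rho> (grid_cell m) (G t)))"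
    unfolding E_def using fT ev by (intro finite_measure_subadditive_finite) auto
  also have "\<dots> \<le> real (card ?T) * exp (- \<rho> * p / real m ^ CARD('n))"
    using one by (rule sum_bounded_above)
  also have "card ?T = m ^ (CARD('n) + 1)" by (simp add: card_cartesian_product card_grid_indices)
  finally have PE: "prob E \<le> real m ^ (CARD('n) + 1) * exp (- \<rho> * p / real m ^ CARD('n))" by simp
  obtain B where B: "B \<in> events" "1 - prob E \<le> prob B" "B \<inter> E = {}"
    "\<And>\<omega> i. \<omega> \<in> B \<Longrightarrow> of_nat i < cube_count (Y \<rho>) \<omega> \<Longrightarrow> Y \<rho> i \<omega> \<in> unit_cube"
    by (rule probable_good_points[OF \<rho> Eev]) blast
  show thesis
  proof (rule that[OF B(1)])
    show "1 - real m ^ (CARD('n) + 1) * exp (- \<rho> * p / real m ^ CARD('n)) \<le> prob B"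
      using B(2) PE by linarith
  next
    fix \<omega> assume w: "\<omega> \<in> B"
    then have ws: "\<omega> \<in> space M" using B(1) sets.sets_into_space by blast
    show "coverage_radius (Y \<rho>) (S \<rho>) K \<omega> \<le> ereal (3 * real CARD('n) / (r * real m))"
    proof (rule coverage_radius_le[OF m r])
      fix c :: "'n \<Rightarrow> nat" and k assume "c \<in> grid_indices m" "k < m"
      then have "\<omega> \<notin> avoiding \<rho> (grid_cell m) (G (c, k))" using w B(3) by (auto simp: E_def)
      then obtain i where i: "of_nat i < cube_count (Y \<rho>) \<omega>" "S \<rho> i \<omega> \<in> G (c, k) (grid_cell m (Y \<rho> i \<omega>))"
        using ws by (auto simp: avoiding_def)
      then show "\<exists>i. of_nat i < cube_count (Y \<rho>) \<omega> \<and> Y \<rho> i \<omega> \<in> unit_cube \<and>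
        S \<rho> i \<omega> \<in> steep_directions (away_from_centre (grid_point m c)) \<and>
        grid_cell m (Y \<rho> i \<omega>) = grid_cell m (grid_point m c - (real k / real m) *\<^sub>R slope (S \<rho> i \<omega>))"
        using B(4)[OF w i(1)] by (intro exI[of _ i]) (auto simp: G_def aiming_directions_def)
    qed
  qed
qed

text \<open>
  The targets are spread over the top face at mutual distance at least \<open>5 / m\<close>, which exceeds the
  \<open>4 / m\<close> within which one direction could reach two of them from the same cell. Hence the
  exponents of the void probabilities are additive, the events that a target is missed are
  pairwise independent, and the second moment method applies. Each target is missed with
  probability at least \<open>exp (- \<rho> 5 ^ CARD('n) / m ^ CARD('n))\<close>, since a fixed direction reaches
  it from at most \<open>5 ^ CARD('n)\<close> cells.
\<close>

lemma coverage_radius_ge_probable: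
  fixes K :: "((real ^ 'n) \<times> real) set"
  assumes \<rho>: "0 < \<rho>" and Q: "prob_space Q" and sQ: "sets Q = sets (restrict_space borel upper_hemisphere)"
    and m: "5 \<le> m" and K: "K \<subseteq> cball 0 L" and L: "0 \<le> L" and R0: "0 \<le> R0"
    and small: "(2 * real CARD('n) + 2) * (R0 * L) \<le> 1 / real m"
  obtains B where "B \<in> events"
    "1 - exp (\<rho> * 5 ^ CARD('n) / real m ^ CARD('n)) / real (m div 5) ^ CARD('n) \<le> prob B"
    "\<And>\<omega>. \<omega> \<in> B \<Longrightarrow> ereal R0 \<le> coverage_radius (Y \<rho>) (S \<rho>) K \<omega>"
proof -
  interpret Q: prob_space Q by fact
  have m0: "0 < m" using m by simp
  let ?J = "grid_indices (m div 5) :: ('n \<Rightarrow> nat) set"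
  define target :: "('n \<Rightarrow> nat) \<Rightarrow> real ^ 'n" where "target c = grid_point m (\<lambda>i. 5 * c i)" for c
  define G where "G c = reaching_directions m (target c)" for c
  define E where "E c = avoiding \<rho> (grid_cell m) (G c)" for c
  have GQ: "G t c \<in> sets Q" for t c
    unfolding sets_hemisphere_iff[OF sQ] G_def
    using sets_reaching_directions by (auto simp: reaching_directions_def)
  have ev: "E t \<in> events" for t
    unfolding E_def by (rule sets_avoiding_grid[OF \<rho> Q m0]) (rule GQ)
  have target_cube: "target c \<in> unit_cube" if "c \<in> ?J" for c
    unfolding target_def
  proof (rule grid_point_in_cube)
    show "(\<lambda>i. 5 * c i) \<in> grid_indices m"
      unfolding grid_indices_def
    proof clarify
      fix i
      have "c i < m div 5" using that by (simp add: grid_indices_def)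
      then show "5 * c i < m" by linarith
    qed
  qed
  have disj: "G t c \<inter> G t' c = {}" if "t \<noteq> t'" for t t' c
  proof (rule ccontr)
    assume "G t c \<inter> G t' c \<noteq> {}"
    then obtain s where s: "s \<in> G t c" "s \<in> G t' c" by blast
    obtain i where i: "t i \<noteq> t' i" using \<open>t \<noteq> t'\<close> by auto
    have "\<bar>real (c i) / real m + slope s $ i - real (5 * t i) / real m\<bar> \<le> 2 / real m"
      "\<bar>real (c i) / real m + slope s $ i - real (5 * t' i) / real m\<bar> \<le> 2 / real m"
      using s by (auto simp: G_def reaching_directions_def target_def)
    then have "\<bar>real (5 * t i) / real m - real (5 * t' i) / real m\<bar> \<le> 4 / real m" by linarith
    then have "\<bar>real (5 * t i) - real (5 * t' i)\<bar> \<le> 4"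
      using m0 unfolding diff_divide_distrib[symmetric] by (simp add: abs_divide divide_le_cancel)
    then show False using i by linarith
  qed
  have pE: "prob (E t) = exp (- \<rho> / real m ^ CARD('n) * (\<Sum>c\<in>grid_indices m. measure Q (G t c)))" for t
    unfolding E_def by (rule prob_avoiding_grid[OF \<rho> Q m0 GQ])
  have pair: "prob (E t \<inter> E t') = prob (E t) * prob (E t')" if "t \<noteq> t'" for t t'
  proof -
    have "E t \<inter> E t' = avoiding \<rho> (grid_cell m) (\<lambda>c. G t c \<union> G t' c)"
      by (auto simp: E_def avoiding_def)
    then have "prob (E t \<inter> E t') =
        exp (- \<rho> / real m ^ CARD('n) * (\<Sum>c\<in>grid_indices m. measure Q (G t c \<union> G t' c)))"
      using prob_avoiding_grid[OF \<rho> Q m0, of "\<lambda>c. G t c \<union> G t' c"] GQ by auto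
    also have "(\<Sum>c\<in>grid_indices m. measure Q (G t c \<union> G t' c)) =
        (\<Sum>c\<in>grid_indices m. measure Q (G t c)) + (\<Sum>c\<in>grid_indices m. measure Q (G t' c))"
      using GQ disj[OF that] by (simp add: Q.finite_measure_Union sum.distrib)
    finally show ?thesis by (simp only: pE distrib_left exp_add)
  qed
  let ?e = "exp (- \<rho> * 5 ^ CARD('n) / real m ^ CARD('n))"
  have lower: "?e \<le> prob (E t)" for t
  proof -
    have "(\<Sum>c\<in>grid_indices m. measure Q (G t c)) \<le> real (5 ^ CARD('n))"
      using GQ card_reaching_cells[OF m0] unfolding G_def
      by (intro Q.sum_prob_le_multiplicity finite_grid_indices) auto
    then have "\<rho> / real m ^ CARD('n) * (\<Sum>c\<in>grid_indices m. measure Q (G t c))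
        \<le> \<rho> / real m ^ CARD('n) * 5 ^ CARD('n)"
      using \<rho> by (intro mult_left_mono) auto
    then show ?thesis by (simp add: pE)
  qed
  have J0: "0 < real (m div 5) ^ CARD('n)" using m by (auto intro!: zero_less_power simp: div_greater_zero_iff)
  have "real (m div 5) ^ CARD('n) * ?e \<le> (\<Sum>t\<in>?J. prob (E t))"
    using sum_bounded_below[of ?J ?e "\<lambda>t. prob (E t)"] lower by (simp add: card_grid_indices)
  moreover have pos: "0 < real (m div 5) ^ CARD('n) * ?e" using J0 by simp
  ultimately have "1 / (\<Sum>t\<in>?J. prob (E t)) \<le> 1 / (real (m div 5) ^ CARD('n) * ?e)"
     and spos: "0 < (\<Sum>t\<in>?J. prob (E t))"
    by (auto intro!: divide_left_mono mult_pos_pos)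
  then have bad: "prob (space M - (\<Union>t\<in>?J. E t)) \<le> 1 / (real (m div 5) ^ CARD('n) * ?e)"
    using second_moment_avoid[of ?J E] finite_grid_indices ev pair by fastforce
  obtain B where B: "B \<in> events" "1 - prob (space M - (\<Union>t\<in>?J. E t)) \<le> prob B"
      "B \<inter> (space M - (\<Union>t\<in>?J. E t)) = {}"
    "\<And>\<omega> i. \<omega> \<in> B \<Longrightarrow> of_nat i < cube_count (Y \<rho>) \<omega> \<Longrightarrow> Y \<rho> i \<omega> \<in> unit_cube"
    by (rule probable_good_points[OF \<rho>, of "space M - (\<Union>t\<in>?J. E t)"])
      (use finite_grid_indices ev in auto)
  have spaceQ: "space Q = upper_hemisphere"
    using sets_eq_imp_space_eq[OF sQ] by (simp add: space_restrict_space)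
  show thesis
  proof (rule that[OF B(1)])
    have "1 / (real (m div 5) ^ CARD('n) * ?e) =
        exp (\<rho> * 5 ^ CARD('n) / real m ^ CARD('n)) / real (m div 5) ^ CARD('n)"
      by (simp add: exp_minus field_simps)
    then show "1 - exp (\<rho> * 5 ^ CARD('n) / real m ^ CARD('n)) / real (m div 5) ^ CARD('n) \<le> prob B"
      using B(2) bad by linarith
  next
    fix \<omega> assume w: "\<omega> \<in> B"
    then have ws: "\<omega> \<in> space M" using B(1) sets.sets_into_space by blast
    then obtain t where t: "t \<in> ?J" "\<omega> \<in> E t" using w B(3) by blast
    show "ereal R0 \<le> coverage_radius (Y \<rho>) (S \<rho>) K \<omega>"
    proof (rule coverage_radius_ge[OF m0 K L R0 small target_cube[OF t(1)]])
      fix i assume i: "of_nat i < cube_count (Y \<rho>) \<omega>"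
      show "Y \<rho> i \<omega> \<in> unit_cube \<and> S \<rho> i \<omega> \<in> upper_hemisphere"
        using B(4)[OF w i] measurable_space[OF S_measurable[OF \<rho>] ws, of i] spaceQ by simp
      show "S \<rho> i \<omega> \<notin> reaching_directions m (target t) (grid_cell m (Y \<rho> i \<omega>))"
        using t(2) i by (auto simp: E_def avoiding_def G_def)
    qed
  qed
qed

end

section \<open>Choice of the scales\<close>

lemma inner_prob_bounds:
  assumes "prob_space M" "B \<in> sets M" "B \<subseteq> A"
  shows "measure M B \<le> inner_prob M A" "inner_prob M A \<le> 1"
proof -
  interpret prob_space M by fact
  show "measure M B \<le> inner_prob M A"
    unfolding inner_prob_def using assms(2,3)
    by (intro cSUP_upper) (auto intro!: bdd_aboveI[of _ 1])
  show "inner_prob M A \<le> 1"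
    unfolding inner_prob_def using assms(2,3) by (intro cSUP_least) auto
qed

lemma scale_choice:
  fixes B u :: real
  assumes "1 \<le> B * u"
  obtains m :: nat where "B * u \<le> real m" "real m \<le> 2 * B * u"
  using assms by (intro that[of "nat \<lceil>B * u\<rceil>"]) linarith+

text \<open>
  With this cell size a cell contains at least \<open>3 ln \<rho> / p\<close> points on average, so a grid
  point is missed with probability at most \<open>1 / \<rho> ^ 3\<close>, while there are at most \<open>\<rho>\<^sup>2\<close> grid points
  because \<open>(n + 1) / n \<le> 2\<close>.
\<close>

lemma cell_scale_upper_failure:
  fixes \<rho> p :: real
  assumes n: "0 < n" and \<rho>: "1 \<le> ln \<rho>" "0 < \<rho>" and u: "1 \<le> u" "u ^ n = \<rho> / ln \<rho>"
    and p: "0 < p" "p \<le> 1" and m: "0 < m" "real m \<le> p / 3 * u"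
  shows "real m ^ (n + 1) * exp (- \<rho> * p / real m ^ n) \<le> 1 / \<rho>"
proof -
  have "(p / 3) ^ n \<le> p / 3" using n p power_decreasing[of 1 n "p / 3"] by simp
  then have "(p / 3) ^ n * u ^ n \<le> p / 3 * u ^ n" using u(1) by (intro mult_right_mono) auto
  moreover have "real m ^ n \<le> (p / 3 * u) ^ n" using m by (intro power_mono) auto
  ultimately have "real m ^ n \<le> p / 3 * (\<rho> / ln \<rho>)"
    unfolding power_mult_distrib u(2) by linarith
  moreover have "0 \<le> 3 * ln \<rho>" using \<rho>(1) by linarith
  ultimately have "real m ^ n * (3 * ln \<rho>) \<le> p / 3 * (\<rho> / ln \<rho>) * (3 * ln \<rho>)"
    by (rule mult_right_mono)
  also have "\<dots> = \<rho> * p" using \<rho> by auto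
  finally have "3 * ln \<rho> \<le> \<rho> * p / real m ^ n" using m by (simp add: field_simps)
  then have "exp (- \<rho> * p / real m ^ n) \<le> exp (- (3 * ln \<rho>))" by simp
  also have "\<dots> = 1 / \<rho> ^ 3"
    using \<rho> exp_of_nat_mult[of 3 "ln \<rho>"] by (simp add: exp_minus divide_inverse)
  finally have e: "exp (- \<rho> * p / real m ^ n) \<le> 1 / \<rho> ^ 3" .
  have "p * u \<le> 1 * u" using p(2) u(1) by (intro mult_right_mono) auto
  then have "real m \<le> u" using m(2) u(1) by linarith
  have quot: "\<rho> / ln \<rho> \<le> \<rho>" "0 \<le> \<rho> / ln \<rho>"
    using divide_left_mono[of 1 "ln \<rho>" \<rho>] divide_nonneg_nonneg[of \<rho> "ln \<rho>"] \<rho>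
    by linarith+
  have "real m ^ (n + 1) \<le> u ^ (n + 1)" using \<open>real m \<le> u\<close> by (intro power_mono) auto
  also have "\<dots> \<le> u ^ (n * 2)" using n u by (intro power_increasing) auto
  also have "\<dots> = (\<rho> / ln \<rho>)\<^sup>2" by (simp add: power_mult u(2))
  also have "\<dots> \<le> \<rho>\<^sup>2" using quot by (intro power_mono)
  finally have "real m ^ (n + 1) * exp (- \<rho> * p / real m ^ n) \<le> \<rho>\<^sup>2 * (1 / \<rho> ^ 3)"
    using e by (intro mult_mono) auto
  also have "\<dots> = 1 / \<rho>" using \<rho> by (simp add: power2_eq_square power3_eq_cube)
  finally show ?thesis .
qed

text \<open>
  With this cell size five to the power \<open>n\<close> cells contain at most \<open>ln \<rho> / 2\<close> points on average,
  so a target is missed with probability at least \<open>1 / sqrt \<rho>\<close>, while there are at least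
  \<open>\<rho> / ln \<rho>\<close> targets.
\<close>

lemma cell_scale_lower_failure:
  fixes \<rho> u :: real
  assumes n: "0 < n" and \<rho>: "1 \<le> ln \<rho>" "0 < \<rho>" and u: "1 \<le> u" "u ^ n = \<rho> / ln \<rho>"
    and m: "10 * u \<le> real m"
  shows "exp (\<rho> * 5 ^ n / real m ^ n) / real (m div 5) ^ n \<le> ln \<rho> / sqrt \<rho>"
proof -
  have m0: "0 < real m" using m u by simp
  have "(10 * u) ^ n \<le> real m ^ n" using m u by (intro power_mono) auto
  moreover have "(2 :: real) \<le> 2 ^ n" using n self_le_power[of "2 :: real" n] by simp
  then have "2 * (5 ^ n * u ^ n) \<le> 2 ^ n * (5 ^ n * u ^ n)" using u(1) by (intro mult_right_mono) auto
  moreover have "(10 * u) ^ n = 2 ^ n * (5 ^ n * u ^ n)"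
    using power_mult_distrib[of 2 "5 * u" n] power_mult_distrib[of 5 u n] by simp
  ultimately have "2 * (5 ^ n * u ^ n) \<le> real m ^ n" by linarith
  moreover have lpos: "0 < ln \<rho>" using \<rho>(1) by linarith
  ultimately have "2 * (5 ^ n * (\<rho> / ln \<rho>)) * ln \<rho> \<le> real m ^ n * ln \<rho>"
    unfolding u(2) by (intro mult_right_mono) linarith+
  moreover have "2 * (5 ^ n * (\<rho> / ln \<rho>)) * ln \<rho> = 2 * (\<rho> * 5 ^ n)" using lpos by simp
  ultimately have "2 * (\<rho> * 5 ^ n) \<le> real m ^ n * ln \<rho>" by (simp only:)
  then have "\<rho> * 5 ^ n \<le> ln \<rho> / 2 * real m ^ n" by (simp add: mult.commute)
  then have "\<rho> * 5 ^ n / real m ^ n \<le> ln \<rho> / 2" using m0 by (simp add: pos_divide_le_eq)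
  then have "exp (\<rho> * 5 ^ n / real m ^ n) \<le> exp (ln \<rho> / 2)" by simp
  also have "\<dots> = sqrt \<rho>" using \<rho> by (simp add: ln_sqrt[symmetric])
  finally have e: "exp (\<rho> * 5 ^ n / real m ^ n) \<le> sqrt \<rho>" .
  have "10 \<le> m" using m u by linarith
  then have "m \<le> 10 * (m div 5)" by linarith
  then have "real m \<le> real (10 * (m div 5))" by (rule of_nat_mono)
  then have "u \<le> real (m div 5)" using m by simp
  then have "u ^ n \<le> real (m div 5) ^ n" using u(1) by (intro power_mono) auto
  moreover have "0 < u ^ n" using u(1) by simp
  ultimately have "exp (\<rho> * 5 ^ n / real m ^ n) / real (m div 5) ^ n \<le> sqrt \<rho> / u ^ n"
    using e \<rho>(2) by (intro frac_le) auto
  also have "\<dots> = ln \<rho> / sqrt \<rho>"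
    using \<rho> by (simp add: u(2) real_div_sqrt field_simps)
  finally show ?thesis .
qed

lemma eventually_scale_ge:
  fixes a C :: real
  assumes "0 < a"
  shows "\<forall>\<^sub>F \<rho> in at_top. C \<le> (\<rho> / ln \<rho>) powr a"
proof -
  have "filterlim (\<lambda>\<rho>::real. (\<rho> / ln \<rho>) powr a) at_top at_top"
    using assms by real_asymp
  then show ?thesis by (simp add: filterlim_at_top)
qed

theorem theorem1p3:
  fixes K :: "((real ^ 'n) \<times> real) set"
    and Q :: "((real ^ 'n) \<times> real) measure"
    and r p\<^sub>S :: real
  assumes "bounded K"
    and "0 < r" and "cball 0 r \<times> {0} \<subseteq> K"
    and "prob_space Q" and "sets Q = sets (restrict_space borel upper_hemisphere)"
    and "0 < p\<^sub>S"
    and "\<And>z :: 'n \<Rightarrow> real. (\<forall>i. z i \<in> {-1, 1}) \<Longrightarrow> p\<^sub>S < measure Q (closure (orthant_directions z))"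
  shows "\<exists>c\<^sub>1 c\<^sub>2 :: real. 0 < c\<^sub>1 \<and> c\<^sub>1 \<le> c\<^sub>2 \<and>
    (\<forall>(M :: 'w measure) Y S. cylinder_model M Q Y S \<longrightarrow>
      ((\<lambda>\<rho>. inner_prob M {\<omega> \<in> space M.
           ereal c\<^sub>1 \<le> coverage_radius (Y \<rho>) (S \<rho>) K \<omega> / ereal ((ln \<rho> / \<rho>) powr (1 / real CARD('n))) \<and>
           coverage_radius (Y \<rho>) (S \<rho>) K \<omega> / ereal ((ln \<rho> / \<rho>) powr (1 / real CARD('n))) \<le> ereal c\<^sub>2})
        \<longlongrightarrow> 1) at_top)"
proof -
  interpret Q: prob_space Q by fact
  let ?n = "CARD('n)"
  let ?p = "p\<^sub>S"
  note sQ = assms(5)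
  have n0: "0 < ?n" by simp
  have inv_n: "0 < 1 / real ?n" by simp
  have p: "?p \<le> measure Q (steep_directions z)" if "\<forall>i. z i \<in> {-1, 1}" for z :: "'n \<Rightarrow> real"
  proof -
    have "steep_directions z \<in> sets Q"
      unfolding sets_hemisphere_iff[OF sQ] using borel_closed[OF closed_steep_directions]
      by (auto simp: steep_directions_def)
    then show ?thesis
      using assms(7)[OF that] Q.finite_measure_mono[OF closure_orthant_subset_steep[of z]] by simp
  qed
  have p1: "?p \<le> 1"
    using p[of "\<lambda>_. 1"] Q.prob_le_1[of "steep_directions (\<lambda>_. 1)"] by (simp add: order_trans)
  from \<open>bounded K\<close> obtain L where L: "0 < L" "K \<subseteq> cball 0 L"
    unfolding bounded_pos subset_iff mem_cball dist_0_norm by blast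
  \<comment> \<open>The two grids have about \<open>10 u\<close> and \<open>p\<^sub>S u / 6\<close> cells per axis, where \<open>u\<close> is the inverse of
      the normalising factor; up to a factor \<open>2\<close> from rounding, the constants are the radii
      that these grids control. The maximum only ensures that the constants are ordered.\<close>
  define c\<^sub>1 where "c\<^sub>1 = 1 / (20 * (2 * real ?n + 2) * L)"
  define b\<^sub>2 where "b\<^sub>2 = 18 * real ?n / (r * ?p)"
  define c\<^sub>2 where "c\<^sub>2 = max c\<^sub>1 b\<^sub>2"
  have c1: "0 < c\<^sub>1" using L by (simp add: c\<^sub>1_def add_pos_pos)
  have main: "((\<lambda>\<rho>. inner_prob M {\<omega> \<in> space M.
           ereal c\<^sub>1 \<le> coverage_radius (Y \<rho>) (S \<rho>) K \<omega> / ereal ((ln \<rho> / \<rho>) powr (1 / real ?n)) \<and>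
           coverage_radius (Y \<rho>) (S \<rho>) K \<omega> / ereal ((ln \<rho> / \<rho>) powr (1 / real ?n)) \<le> ereal c\<^sub>2})
        \<longlongrightarrow> 1) at_top" (is "((\<lambda>\<rho>. inner_prob M (?A \<rho>)) \<longlongrightarrow> 1) at_top")
    if "cylinder_model M Q Y S" for M :: "'w measure" and Y S
  proof -
    interpret cylinder_model M Q Y S by fact
    have M: "prob_space M" by unfold_locales
    have ev: "\<forall>\<^sub>F \<rho> in at_top. 1 - (1 / \<rho> + ln \<rho> / sqrt \<rho>) \<le> inner_prob M (?A \<rho>) \<and> inner_prob M (?A \<rho>) \<le> 1"
      using eventually_scale_ge[OF inv_n, of "6 / ?p"] eventually_ge_at_top[of "exp 1 :: real"] eventually_gt_at_top[of "0::real"]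
    proof eventually_elim
      case (elim \<rho>)
      define u where "u = (\<rho> / ln \<rho>) powr (1 / real ?n)"
      define \<delta> where "\<delta> = (ln \<rho> / \<rho>) powr (1 / real ?n)"
      have l: "1 \<le> ln \<rho>" using elim by (simp add: ln_ge_iff)
      have \<rho>: "0 < \<rho>" using elim by simp
      have quot: "0 < \<rho> / ln \<rho>" using l \<rho> by (intro divide_pos_pos) linarith+
      have un: "u ^ ?n = \<rho> / ln \<rho>"
      proof -
        have "u ^ ?n = u powr real ?n" using quot by (intro powr_realpow[symmetric]) (auto simp: u_def)
        also have "\<dots> = (\<rho> / ln \<rho>) powr (1 / real ?n * real ?n)"
          unfolding u_def by (rule powr_powr)
        also have "\<dots> = (\<rho> / ln \<rho>) powr 1" by (rule arg_cong[where f = "(powr) _"]) simp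
        also have "\<dots> = \<rho> / ln \<rho>" using quot by (simp only: powr_one less_imp_le)
        finally show ?thesis .
      qed
      have ud: "u = 1 / \<delta>"
        using l \<rho> by (simp add: u_def \<delta>_def powr_divide)
      have \<delta>: "0 < \<delta>" using l \<rho> by (auto simp: \<delta>_def)
      have u6: "6 / ?p \<le> u" using elim by (simp add: u_def)
      moreover have "6 \<le> 6 / ?p" using p1 assms(6) by (simp add: le_divide_eq)
      ultimately have u1: "1 \<le> u" by linarith
      have "1 \<le> ?p / 6 * u" using u6 assms(6) by (simp add: field_simps)
      then obtain m where m: "?p / 6 * u \<le> real m" "real m \<le> 2 * (?p / 6) * u" by (rule scale_choice)
      have m0: "0 < m" using m(1) \<open>1 \<le> ?p / 6 * u\<close> by linarith
      have "1 \<le> 10 * u" using u1 by simp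
      then obtain k where k: "10 * u \<le> real k" "real k \<le> 2 * 10 * u" by (rule scale_choice)
      have k0: "0 < real k" "5 \<le> k" using k(1) u1 by linarith+
      obtain B where B: "B \<in> events"
        "1 - real m ^ (?n + 1) * exp (- \<rho> * ?p / real m ^ ?n) \<le> prob B"
        "\<And>\<omega>. \<omega> \<in> B \<Longrightarrow> coverage_radius (Y \<rho>) (S \<rho>) K \<omega> \<le> ereal (3 * real ?n / (r * real m))"
        by (rule coverage_radius_le_probable[OF \<rho> assms(4) sQ m0 assms(2,3) p]) blast+
      have small: "(2 * real ?n + 2) * ((c\<^sub>1 * \<delta>) * L) \<le> 1 / real k"
      proof -
        have "(2 * real ?n + 2) * ((c\<^sub>1 * \<delta>) * L) = ((2 * real ?n + 2) * L * c\<^sub>1) * \<delta>" by simp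
        also have "(2 * real ?n + 2) * L * c\<^sub>1 = 1 / 20"
          using L by (simp add: c\<^sub>1_def add_pos_pos add_nonneg_eq_0_iff)
        also have "1 / 20 * \<delta> = 1 / (2 * 10 * u)" using \<delta> by (simp add: ud)
        also have "\<dots> \<le> 1 / real k" using k k0 by (intro divide_left_mono) auto
        finally show ?thesis .
      qed
      obtain B' where B': "B' \<in> events"
        "1 - exp (\<rho> * 5 ^ ?n / real k ^ ?n) / real (k div 5) ^ ?n \<le> prob B'"
        "\<And>\<omega>. \<omega> \<in> B' \<Longrightarrow> ereal (c\<^sub>1 * \<delta>) \<le> coverage_radius (Y \<rho>) (S \<rho>) K \<omega>"
        by (rule coverage_radius_ge_probable[OF \<rho> assms(4) sQ k0(2) L(2) _ _ small])
          (use L c1 \<delta> in auto)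
      have f1: "real m ^ (?n + 1) * exp (- \<rho> * ?p / real m ^ ?n) \<le> 1 / \<rho>"
        using m by (intro cell_scale_upper_failure[OF n0 l \<rho> u1 un assms(6) p1 m0]) simp
      have f2: "exp (\<rho> * 5 ^ ?n / real k ^ ?n) / real (k div 5) ^ ?n \<le> ln \<rho> / sqrt \<rho>"
        by (rule cell_scale_lower_failure[OF n0 l \<rho> u1 un k(1)])
      have "3 * real ?n / (r * real m) \<le> 3 * real ?n / (r * (?p / 6 * u))"
        using m(1) assms(2,6) u1 m0 by (intro divide_left_mono mult_left_mono mult_pos_pos) auto
      also have "\<dots> = b\<^sub>2 * \<delta>" using \<delta> assms(2,6) by (simp add: ud b\<^sub>2_def field_simps)
      also have "\<dots> \<le> \<delta> * c\<^sub>2" using \<delta> by (simp add: c\<^sub>2_def mult.commute)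
      finally have up: "3 * real ?n / (r * real m) \<le> \<delta> * c\<^sub>2" .
      have sub: "B \<inter> B' \<subseteq> ?A \<rho>"
      proof
        fix \<omega> assume w: "\<omega> \<in> B \<inter> B'"
        then have ws: "\<omega> \<in> space M" using B(1) sets.sets_into_space by blast
        have "ereal \<delta> * ereal c\<^sub>1 \<le> coverage_radius (Y \<rho>) (S \<rho>) K \<omega>"
          using B'(3)[of \<omega>] w by (simp add: mult.commute)
        then have 1: "ereal c\<^sub>1 \<le> coverage_radius (Y \<rho>) (S \<rho>) K \<omega> / ereal \<delta>"
          using \<delta> by (subst ereal_le_divide_pos) auto
        have "coverage_radius (Y \<rho>) (S \<rho>) K \<omega> \<le> ereal (\<delta> * c\<^sub>2)"
          using B(3)[of \<omega>] w up by (meson IntD1 ereal_less_eq(3) order_trans)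
        then have 2: "coverage_radius (Y \<rho>) (S \<rho>) K \<omega> / ereal \<delta> \<le> ereal c\<^sub>2"
          using \<delta> by (subst ereal_divide_le_pos) auto
        show "\<omega> \<in> ?A \<rho>" using ws 1 2 unfolding \<delta>_def by blast
      qed
      have "prob (space M - (B \<inter> B')) \<le> prob (space M - B) + prob (space M - B')"
        using B(1) B'(1) measure_Un_le[of "space M - B" M "space M - B'"] by (simp add: Diff_Int)
      then have "1 - (1 / \<rho> + ln \<rho> / sqrt \<rho>) \<le> prob (B \<inter> B')"
        using B(1,2) B'(1,2) f1 f2 by (simp add: prob_compl)
      then show ?case
        using inner_prob_bounds[OF M _ sub] B(1) B'(1) by fastforce
    qed
    show ?thesis
    proof (rule tendsto_sandwich)
      show "\<forall>\<^sub>F \<rho> in at_top. 1 - (1 / \<rho> + ln \<rho> / sqrt \<rho>) \<le> inner_prob M (?A \<rho>)"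
        using ev by (rule eventually_mono) (rule conjunct1)
      show "\<forall>\<^sub>F \<rho> in at_top. inner_prob M (?A \<rho>) \<le> 1"
        using ev by (rule eventually_mono) (rule conjunct2)
      show "((\<lambda>\<rho>::real. 1 - (1 / \<rho> + ln \<rho> / sqrt \<rho>)) \<longlongrightarrow> 1) at_top" by real_asymp
    qed (rule tendsto_const)
  qed
  have "c\<^sub>1 \<le> c\<^sub>2" by (simp add: c\<^sub>2_def)
  then show ?thesis using c1 main by blast
qed

end
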